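(* Let $k\ge3$ and consider the group $G=\mathbb Z/2\mathbb Z\star\mathbb Z/k\mathbb Z$, the generators of the two cyclic groups being respectively $a$ and $b$. Consider the simple random walk $(G,\mu)$ with $\mu(a)=\mu(b)=\mu(b^{-1})=1/3$. Let $G_n:[0,1]\to\mathbb R$, $n\in\mathbb N$, be defined by $$G_0(x)=\frac14+\frac x2,\quad G_1(x)=x,\quad G_n(x)=\frac{8(1-x)}{3-2x}G_{n-1}(x)-G_{n-2}(x)\ \ (n\ge2),$$ and let $y_k$ be the unique solution in $(0,1/2)$ of $G_{k-1}(y)=y$. Then the harmonic measure of $(G,\mu)$ is the Markovian multiplicative measure associated with the vector $r$ given by $r(a)=G_0(y_k)$ and $r(b^i)=G_i(y_k)$ for $i\in\{1,\dots,k-1\}$. The drift is $\gamma_k=(1-2y_k)/3$. It is a strictly increasing function of $k$, and $\lim_{k\to\infty}\gamma_k=2/9$.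
   Context: $\Sigma=\Sigma_1\sqcup\Sigma_2$ with $\Sigma_1=\{a\}$, $\Sigma_2=\{b,\dots,b^{k-1}\}$; $\Sigma_u$ is the $\Sigma_i$ containing $u$. Elements of $G$ are identified with the set $L$ of finite words over $\Sigma$ with consecutive letters in different $\Sigma_i$'s (empty word $=1$); $|g|$ is the number of letters of $g$, i.e. the word length with respect to $\Sigma$ (not with respect to $\{a,b^{\pm1}\}$). Random walk: $X_0=1$, $X_{n+1}=X_n\ast x_n$ with $(x_n)$ i.i.d. of law $\mu$. The drift is the a.s. constant limit $\lim_n|X_n|/n$. The harmonic measure is the law of the a.s. limit $X_\infty$ of $X_n$, an infinite word with alternating factors (the common prefix length of $X_n$ and $X_\infty$ tends to infinity). For $r\in\mathbb R^\Sigma$ with positive entries summing to $1$, and $r(S)=\sum_{u\in S}r(u)$, the Markovian multiplicative measure associated with $r$ gives to the cylinder $u_1\cdots u_m\Sigma^{\mathbb N}$ (for nonempty $u_1\cdots u_m\in L$) the mass $\frac{r(u_1)}{r(\Sigma\setminus\Sigma_{u_1})}\cdots\frac{r(u_{m-1})}{r(\Sigma\setminus\Sigma_{u_{m-1}})}r(u_m)$. The existence and uniqueness of $y_k$ is part of the assertion. *)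

theory Defs
  imports
    "HOL-Probability.Probability"
    "HOL-Algebra.Elementary_Groups"
    "HOL-Library.Sublist"
begin

section \<open>Free products of two groups\<close>

text \<open>
  Elements of the free product are represented by their normal forms: finite words over the
  disjoint union of the non-trivial elements of the two factors, in which consecutive letters come
  from different factors.
\<close>

definition letters :: "('a, 'm) monoid_scheme \<Rightarrow> ('b, 'n) monoid_scheme \<Rightarrow> ('a + 'b) set" where
  "letters G H = Inl ` (carrier G - {\<one>\<^bsub>G\<^esub>}) \<union> Inr ` (carrier H - {\<one>\<^bsub>H\<^esub>})"

definition normal_words :: "('a, 'm) monoid_scheme \<Rightarrow> ('b, 'n) monoid_scheme \<Rightarrow> ('a + 'b) list set" where
  "normal_words G H = {w \<in> lists (letters G H). successively (\<lambda>u v. isl u \<noteq> isl v) w}"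

text \<open>Left multiplication of a normal form by a single letter.\<close>

fun letter_mult ::
  "('a, 'm) monoid_scheme \<Rightarrow> ('b, 'n) monoid_scheme \<Rightarrow> 'a + 'b \<Rightarrow> ('a + 'b) list \<Rightarrow> ('a + 'b) list"
where
  "letter_mult G H (Inl g) (Inl g' # w) =
     (if g \<otimes>\<^bsub>G\<^esub> g' = \<one>\<^bsub>G\<^esub> then w else Inl (g \<otimes>\<^bsub>G\<^esub> g') # w)"
| "letter_mult G H (Inr h) (Inr h' # w) =
     (if h \<otimes>\<^bsub>H\<^esub> h' = \<one>\<^bsub>H\<^esub> then w else Inr (h \<otimes>\<^bsub>H\<^esub> h') # w)"
| "letter_mult G H u w = u # w"

definition free_product ::
  "('a, 'm) monoid_scheme \<Rightarrow> ('b, 'n) monoid_scheme \<Rightarrow> ('a + 'b) list monoid"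
where
  "free_product G H =
     \<lparr>carrier = normal_words G H, monoid.mult = foldr (letter_mult G H), one = []\<rparr>"

lemma free_product_simps [simp]:
  "carrier (free_product G H) = normal_words G H"
  "monoid.mult (free_product G H) = foldr (letter_mult G H)"
  "one (free_product G H) = []"
  by (simp_all add: free_product_def)

lemma letters_simps [simp]:
  "Inl g \<in> letters G H \<longleftrightarrow> g \<in> carrier G \<and> g \<noteq> \<one>\<^bsub>G\<^esub>"
  "Inr h \<in> letters G H \<longleftrightarrow> h \<in> carrier H \<and> h \<noteq> \<one>\<^bsub>H\<^esub>"
  by (auto simp: letters_def)

lemma normal_words_Nil [simp]: "[] \<in> normal_words G H"
  by (simp add: normal_words_def)

lemma normal_words_Cons:
  "u # w \<in> normal_words G H \<longleftrightarrow>
     u \<in> letters G H \<and> w \<in> normal_words G H \<and> (w = [] \<or> isl u \<noteq> isl (hd w))"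
  by (auto simp: normal_words_def successively_Cons)

context
  fixes G :: "('a, 'm) monoid_scheme" and H :: "('b, 'n) monoid_scheme"
  assumes grp: "group G" "group H"
begin

interpretation G: group G by (rule grp)
interpretation H: group H by (rule grp)

lemma letter_mult_closed:
  assumes "u \<in> letters G H" "w \<in> normal_words G H"
  shows "letter_mult G H u w \<in> normal_words G H"
  using assms by (cases w; cases u; cases "hd w") (auto simp: normal_words_Cons)

lemma foldr_letter_mult_closed:
  assumes "v \<in> normal_words G H" "w \<in> normal_words G H"
  shows "foldr (letter_mult G H) v w \<in> normal_words G H"
  using assms by (induction v) (auto simp: normal_words_Cons letter_mult_closed)

lemma letter_mult_Inl_other:
  assumes "w = [] \<or> \<not> isl (hd w)"
  shows "letter_mult G H (Inl p) w = Inl p # w"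
  using assms by (cases w; cases "hd w") auto

lemma letter_mult_Inr_other:
  assumes "w = [] \<or> isl (hd w)"
  shows "letter_mult G H (Inr p) w = Inr p # w"
  using assms by (cases w; cases "hd w") auto

lemma letter_mult_Inl_Inl:
  assumes "Inl p \<in> letters G H" "Inl q \<in> letters G H" "w \<in> normal_words G H"
  shows "letter_mult G H (Inl p) (letter_mult G H (Inl q) w) =
           (if p \<otimes>\<^bsub>G\<^esub> q = \<one>\<^bsub>G\<^esub> then w else letter_mult G H (Inl (p \<otimes>\<^bsub>G\<^esub> q)) w)"
proof (cases "w = [] \<or> \<not> isl (hd w)")
  case True
  then show ?thesis by (simp add: letter_mult_Inl_other)
next
  case False
  then obtain s t where w: "w = Inl s # t" by (cases w; cases "hd w") auto
  have t: "t = [] \<or> \<not> isl (hd t)" and s: "s \<in> carrier G" "s \<noteq> \<one>\<^bsub>G\<^esub>"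
    using assms(3) by (auto simp: w normal_words_Cons)
  have pq: "p \<in> carrier G" "q \<in> carrier G" "p \<noteq> \<one>\<^bsub>G\<^esub>" using assms by auto
  have assoc: "p \<otimes>\<^bsub>G\<^esub> q \<otimes>\<^bsub>G\<^esub> s = p \<otimes>\<^bsub>G\<^esub> (q \<otimes>\<^bsub>G\<^esub> s)"
    using pq s by (simp add: G.m_assoc)
  show ?thesis
  proof (cases "p \<otimes>\<^bsub>G\<^esub> q = \<one>\<^bsub>G\<^esub>")
    case True
    then have "p \<otimes>\<^bsub>G\<^esub> (q \<otimes>\<^bsub>G\<^esub> s) = s" using assoc s by simp
    then show ?thesis using True pq s t by (auto simp: w letter_mult_Inl_other)
  next
    case False
    then show ?thesis using pq s t assoc by (auto simp: w letter_mult_Inl_other)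
  qed
qed

lemma letter_mult_Inr_Inr:
  assumes "Inr p \<in> letters G H" "Inr q \<in> letters G H" "w \<in> normal_words G H"
  shows "letter_mult G H (Inr p) (letter_mult G H (Inr q) w) =
           (if p \<otimes>\<^bsub>H\<^esub> q = \<one>\<^bsub>H\<^esub> then w else letter_mult G H (Inr (p \<otimes>\<^bsub>H\<^esub> q)) w)"
proof (cases "w = [] \<or> isl (hd w)")
  case True
  then show ?thesis by (simp add: letter_mult_Inr_other)
next
  case False
  then obtain s t where w: "w = Inr s # t" by (cases w; cases "hd w") auto
  have t: "t = [] \<or> isl (hd t)" and s: "s \<in> carrier H" "s \<noteq> \<one>\<^bsub>H\<^esub>"
    using assms(3) by (auto simp: w normal_words_Cons)
  have pq: "p \<in> carrier H" "q \<in> carrier H" "p \<noteq> \<one>\<^bsub>H\<^esub>" using assms by auto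
  have assoc: "p \<otimes>\<^bsub>H\<^esub> q \<otimes>\<^bsub>H\<^esub> s = p \<otimes>\<^bsub>H\<^esub> (q \<otimes>\<^bsub>H\<^esub> s)"
    using pq s by (simp add: H.m_assoc)
  show ?thesis
  proof (cases "p \<otimes>\<^bsub>H\<^esub> q = \<one>\<^bsub>H\<^esub>")
    case True
    then have "p \<otimes>\<^bsub>H\<^esub> (q \<otimes>\<^bsub>H\<^esub> s) = s" using assoc s by simp
    then show ?thesis using True pq s t by (auto simp: w letter_mult_Inr_other)
  next
    case False
    then show ?thesis using pq s t assoc by (auto simp: w letter_mult_Inr_other)
  qed
qed

lemma foldr_letter_mult_assoc1:
  assumes "u \<in> letters G H" "v \<in> normal_words G H" "w \<in> normal_words G H"
  shows "foldr (letter_mult G H) (letter_mult G H u v) w =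
           letter_mult G H u (foldr (letter_mult G H) v w)"
proof (cases v)
  case Nil
  then show ?thesis by (cases u) auto
next
  case (Cons u' v')
  have v': "u' \<in> letters G H" "foldr (letter_mult G H) v' w \<in> normal_words G H"
    using assms Cons by (auto simp: normal_words_Cons intro: foldr_letter_mult_closed)
  show ?thesis
  proof (cases u; cases u')
    fix p q assume "u = Inl p" "u' = Inl q"
    then show ?thesis
      using letter_mult_Inl_Inl[of p q "foldr (letter_mult G H) v' w"] v' assms(1) Cons by auto
  next
    fix p q assume "u = Inr p" "u' = Inr q"
    then show ?thesis
      using letter_mult_Inr_Inr[of p q "foldr (letter_mult G H) v' w"] v' assms(1) Cons by auto
  qed (simp_all add: Cons)
qed

theorem group_free_product: "group (free_product G H)"
proof (rule groupI)
  fix u v w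
  assume "u \<in> carrier (free_product G H)" "v \<in> carrier (free_product G H)"
    and "w \<in> carrier (free_product G H)"
  then show "u \<otimes>\<^bsub>free_product G H\<^esub> v \<otimes>\<^bsub>free_product G H\<^esub> w =
             u \<otimes>\<^bsub>free_product G H\<^esub> (v \<otimes>\<^bsub>free_product G H\<^esub> w)"
    by (induction u)
      (auto simp: normal_words_Cons foldr_letter_mult_assoc1 foldr_letter_mult_closed)
next
  fix w assume "w \<in> carrier (free_product G H)"
  then have "w \<in> normal_words G H" by simp
  then have "\<exists>v \<in> normal_words G H. foldr (letter_mult G H) v w = []"
  proof (induction w)
    case Nil
    show ?case by (rule bexI[of _ "[]"]) auto
  next
    case (Cons u w)
    then obtain v where v: "v \<in> normal_words G H" "foldr (letter_mult G H) v w = []"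
      by (auto simp: normal_words_Cons)
    have "\<exists>u' \<in> letters G H. letter_mult G H u' (u # w) = w"
    proof (cases u)
      case (Inl g)
      then have "Inl (inv\<^bsub>G\<^esub> g) \<in> letters G H" "g \<in> carrier G"
        using Cons.prems by (auto simp: normal_words_Cons)
      then show ?thesis by (intro bexI[of _ "Inl (inv\<^bsub>G\<^esub> g)"]) (auto simp: Inl)
    next
      case (Inr h)
      then have "Inr (inv\<^bsub>H\<^esub> h) \<in> letters G H" "h \<in> carrier H"
        using Cons.prems by (auto simp: normal_words_Cons)
      then show ?thesis by (intro bexI[of _ "Inr (inv\<^bsub>H\<^esub> h)"]) (auto simp: Inr)
    qed
    then obtain u' where u': "u' \<in> letters G H" "letter_mult G H u' (u # w) = w" by blast
    have cl: "v' \<in> normal_words G H \<Longrightarrow>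
        foldr (letter_mult G H) (foldr (letter_mult G H) v' [u']) (u # w) =
        foldr (letter_mult G H) v' w" for v'
    proof (induction v')
      case Nil
      then show ?case using u' by simp
    next
      case (Cons x v')
      have "foldr (letter_mult G H) v' [u'] \<in> normal_words G H"
        using Cons.prems u' by (intro foldr_letter_mult_closed) (auto simp: normal_words_Cons)
      then show ?case
        using Cons \<open>u # w \<in> normal_words G H\<close>
        by (simp add: normal_words_Cons[of x] foldr_letter_mult_assoc1 del: foldr_Cons)
           (simp add: foldr_letter_mult_assoc1)
    qed
    show ?case
      by (rule bexI[of _ "foldr (letter_mult G H) v [u']"])
         (use cl v u' in \<open>auto intro!: foldr_letter_mult_closed simp: normal_words_Cons\<close>)
  qed
  then show "\<exists>v \<in> carrier (free_product G H). v \<otimes>\<^bsub>free_product G H\<^esub> w = \<one>\<^bsub>free_product G H\<^esub>"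
    by simp
qed (auto simp: foldr_letter_mult_closed)

end


section \<open>Random walks, drift and harmonic measure\<close>

definition iid_steps :: "'w measure \<Rightarrow> 'g pmf \<Rightarrow> (nat \<Rightarrow> 'w \<Rightarrow> 'g) \<Rightarrow> bool" where
  "iid_steps M \<mu> x \<longleftrightarrow>
     prob_space M \<and>
     prob_space.indep_vars M (\<lambda>_. count_space UNIV) x UNIV \<and>
     (\<forall>n. distr M (count_space UNIV) (x n) = measure_pmf \<mu>)"

primrec right_walk :: "('g, 'm) monoid_scheme \<Rightarrow> (nat \<Rightarrow> 'w \<Rightarrow> 'g) \<Rightarrow> nat \<Rightarrow> 'w \<Rightarrow> 'g" where
  "right_walk \<Gamma> x 0 \<omega> = \<one>\<^bsub>\<Gamma>\<^esub>"
| "right_walk \<Gamma> x (Suc n) \<omega> = right_walk \<Gamma> x n \<omega> \<otimes>\<^bsub>\<Gamma>\<^esub> x n \<omega>"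

text \<open>
  The length of a normal form is its word length with respect to the generating set of all
  letters. The drift is only meaningful if the almost sure limit exists and is constant.
\<close>

definition drift :: "'w measure \<Rightarrow> (nat \<Rightarrow> 'w \<Rightarrow> 'l list) \<Rightarrow> real" where
  "drift M X = (THE \<gamma>. AE \<omega> in M. (\<lambda>n. real (length (X n \<omega>)) / real n) \<longlonglongrightarrow> \<gamma>)"

definition infinite_normal_words ::
  "('a, 'm) monoid_scheme \<Rightarrow> ('b, 'n) monoid_scheme \<Rightarrow> ('a + 'b) stream set"
where
  "infinite_normal_words G H =
     {s \<in> streams (letters G H). \<forall>i. isl (s !! i) \<noteq> isl (s !! Suc i)}"

definition common_prefix_length :: "'l list \<Rightarrow> 'l stream \<Rightarrow> nat" where
  "common_prefix_length w s = length (longest_common_prefix w (stake (length w) s))"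

definition is_limit_word ::
  "('a, 'm) monoid_scheme \<Rightarrow> ('b, 'n) monoid_scheme \<Rightarrow> 'w measure \<Rightarrow>
   (nat \<Rightarrow> 'w \<Rightarrow> ('a + 'b) list) \<Rightarrow> ('w \<Rightarrow> ('a + 'b) stream) \<Rightarrow> bool"
where
  "is_limit_word G H M X Xinf \<longleftrightarrow>
     Xinf \<in> M \<rightarrow>\<^sub>M stream_space (count_space (letters G H)) \<and>
     (AE \<omega> in M. Xinf \<omega> \<in> infinite_normal_words G H \<and>
        filterlim (\<lambda>n. common_prefix_length (X n \<omega>) (Xinf \<omega>)) at_top sequentially)"

definition is_harmonic_measure ::
  "('a, 'm) monoid_scheme \<Rightarrow> ('b, 'n) monoid_scheme \<Rightarrow> 'w measure \<Rightarrow>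
   (nat \<Rightarrow> 'w \<Rightarrow> ('a + 'b) list) \<Rightarrow> ('a + 'b) stream measure \<Rightarrow> bool"
where
  "is_harmonic_measure G H M X \<nu> \<longleftrightarrow>
     (\<exists>Xinf. is_limit_word G H M X Xinf \<and>
        \<nu> = distr M (stream_space (count_space (letters G H))) Xinf)"

text \<open>
  The set \<open>sstart (letters G H) w\<close> is the cylinder of all infinite words over the alphabet
  that start with \<open>w\<close>; the sum in the denominator ranges over the letters of the other factor.
\<close>

definition markovian_multiplicative ::
  "('a, 'm) monoid_scheme \<Rightarrow> ('b, 'n) monoid_scheme \<Rightarrow> ('a + 'b \<Rightarrow> real) \<Rightarrow>
   ('a + 'b) stream measure \<Rightarrow> bool"
where
  "markovian_multiplicative G H r \<nu> \<longleftrightarrow>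
     (\<forall>u \<in> letters G H. r u > 0) \<and> (\<Sum>u \<in> letters G H. r u) = 1 \<and>
     prob_space \<nu> \<and> sets \<nu> = sets (stream_space (count_space (letters G H))) \<and>
     (\<forall>w \<in> normal_words G H. w \<noteq> [] \<longrightarrow>
        measure \<nu> (sstart (letters G H) w) =
          (\<Prod>i < length w - 1. r (w ! i) / (\<Sum>v \<in> {v \<in> letters G H. isl v \<noteq> isl (w ! i)}. r v))
          * r (last w))"


section \<open>The simple random walk on the free product of two finite cyclic groups\<close>

abbreviation Z2_Zk :: "nat \<Rightarrow> (int + int) list monoid" where
  "Z2_Zk k \<equiv> free_product (integer_mod_group 2) (integer_mod_group k)"

abbreviation gen_a :: "(int + int) list" where
  "gen_a \<equiv> [Inl 1]"

abbreviation gen_b :: "(int + int) list" where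
  "gen_b \<equiv> [Inr 1]"

text \<open>For \<open>k \<ge> 3\<close> the three elements are distinct, so each has mass \<open>1/3\<close>.\<close>

definition simple_step :: "nat \<Rightarrow> (int + int) list pmf" where
  "simple_step k = pmf_of_set {gen_a, gen_b, inv\<^bsub>Z2_Zk k\<^esub> gen_b}"

fun Gn :: "nat \<Rightarrow> real \<Rightarrow> real" where
  "Gn 0 x = 1 / 4 + x / 2"
| "Gn (Suc 0) x = x"
| "Gn (Suc (Suc n)) x = 8 * (1 - x) / (3 - 2 * x) * Gn (Suc n) x - Gn n x"

definition yk :: "nat \<Rightarrow> real" where
  "yk k = (THE y. y \<in> {0<..<1/2} \<and> Gn (k - 1) y = y)"

end

theory Submission
  imports Defs
begin

text \<open>
  Let \<open>\<rho>\<close> be the \<open>k\<close>-periodic extension of \<open>i \<mapsto> Gn i y\<close>, so that \<open>\<rho> 0\<close> is the weight of \<open>a\<close> and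
  \<open>\<rho> i\<close> that of \<open>b ^ i\<close>. The boundary condition \<open>Gn (k - 1) y = y\<close> makes \<open>\<rho>\<close> even, and the recursion
  for \<open>Gn\<close> then says that the multiplicative measure \<open>\<nu>\<close> with these weights is stationary for
  the walk. Integrating a function of \<open>g \<xi>\<close> over a \<open>\<nu>\<close>-random infinite
  word \<open>\<xi>\<close> therefore gives explicit functions of \<open>g\<close> that are well behaved along the walk. The
  cylinder indicators give bounded harmonic functions converging along the walk to the indicators
  of the limit word, which identifies the harmonic measure. The regularised length
  \<open>\<bar>g \<xi>\<bar> - \<bar>\<xi>\<bar>\<close> gives a function within bounded distance of \<open>\<bar>g\<bar>\<close> with constant mean increment
  \<open>(1 - 2 y) / 3\<close>; a fourth moment bound turns this into the almost sure drift.

  The equation for \<open>y\<close> is solved through \<open>s = (1 - 2 y) / (7 - 6 y)\<close> and \<open>t = sqrt s\<close>: the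
  recursion has the characteristic roots \<open>(1 + t) / (1 - t)\<close> and its inverse, and the equation
  becomes \<open>tanh (k artanh t) / t = (2 - 6 s) / (1 - 5 s)\<close>. The left-hand side decreases in \<open>s\<close>
  and increases in \<open>k\<close>, and the right-hand side increases in \<open>s\<close>.
\<close>

section \<open>The equation defining the parameter\<close>

text \<open>The function \<open>tanh (n * artanh (sqrt s)) / sqrt s\<close>, defined by the addition theorem of \<open>tanh\<close>.\<close>

fun tanh_ratio :: "nat \<Rightarrow> real \<Rightarrow> real" where
  "tanh_ratio 0 s = 0"
| "tanh_ratio (Suc n) s = (tanh_ratio n s + 1) / (1 + s * tanh_ratio n s)"

lemma tanh_ratio_nonneg: "0 \<le> s \<Longrightarrow> 0 \<le> tanh_ratio n s"
  by (induction n) auto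

text \<open>With \<open>L = tanh_ratio n s\<close>, the induction step is the identity
  \<open>(1 + s * L)^2 - s * (L + 1)^2 = (1 - s) * (1 - s * L^2)\<close>. In terms of the hyperbolic
  tangent this is \<open>tanh < 1\<close>.\<close>

lemma tanh_ratio_square_less:
  assumes "0 < s" "s < 1"
  shows "s * (tanh_ratio n s)\<^sup>2 < 1"
proof (induction n)
  case (Suc n)
  let ?L = "tanh_ratio n s"
  have L: "0 \<le> ?L" using assms by (simp add: tanh_ratio_nonneg)
  then have pos: "0 < 1 + s * ?L" using assms by (simp add: add_pos_nonneg)
  have "0 < (1 - s) * (1 - s * ?L\<^sup>2)" using Suc assms by simp
  then have "s * (?L + 1)\<^sup>2 < (1 + s * ?L)\<^sup>2" by (simp add: power2_eq_square algebra_simps)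
  then show ?case using pos by (simp add: power_divide divide_simps)
qed simp

text \<open>Clearing the positive denominator turns the claim into
  \<open>s * (tanh_ratio n s)^2 < 1\<close>.\<close>

lemma tanh_ratio_less_Suc:
  assumes "0 < s" "s < 1"
  shows "tanh_ratio n s < tanh_ratio (Suc n) s"
proof -
  have "0 < 1 + s * tanh_ratio n s" using assms by (simp add: add_pos_nonneg tanh_ratio_nonneg)
  then show ?thesis using tanh_ratio_square_less[OF assms, of n]
    by (simp add: pos_less_divide_eq power2_eq_square algebra_simps)
qed

text \<open>One step of the recursion increases with its argument, because \<open>t < 1\<close>, and
  decreases with its parameter. The middle term \<open>(b + 1) / (1 + t * b)\<close> changes one of
  the two at a time.\<close>

lemma tanh_ratio_step_mono:
  fixes a b s t :: real
  assumes "0 \<le> a" "a \<le> b" "0 \<le> s" "s \<le> t" "t < 1"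
  shows "(a + 1) / (1 + t * a) \<le> (b + 1) / (1 + s * b)"
proof -
  have pos: "0 < 1 + t * a" "0 < 1 + t * b" "0 < 1 + s * b"
    using assms by (auto intro!: add_pos_nonneg mult_nonneg_nonneg)
  have "0 \<le> (1 - t) * (b - a)" using assms by simp
  then have "(a + 1) * (1 + t * b) \<le> (b + 1) * (1 + t * a)" by (simp add: algebra_simps)
  then have "(a + 1) / (1 + t * a) \<le> (b + 1) / (1 + t * b)" using pos by (simp add: divide_simps)
  also have "\<dots> \<le> (b + 1) / (1 + s * b)"
    using assms pos by (intro divide_left_mono mult_pos_pos) (auto intro: mult_right_mono)
  finally show ?thesis .
qed

lemma tanh_ratio_antimono:
  assumes "0 \<le> s" "s \<le> t" "t < 1"
  shows "tanh_ratio n t \<le> tanh_ratio n s"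
proof (induction n)
  case (Suc n)
  then show ?case using tanh_ratio_step_mono[of "tanh_ratio n t" "tanh_ratio n s" s t] assms
    by (simp add: tanh_ratio_nonneg)
qed simp

lemma tanh_ratio_at_0: "tanh_ratio n 0 = real n"
  by (induction n) auto

lemma continuous_on_tanh_ratio: "S \<subseteq> {0..} \<Longrightarrow> continuous_on S (tanh_ratio n)"
proof (induction n)
  case (Suc n)
  have "1 + s * tanh_ratio n s \<noteq> 0" if "s \<in> S" for s
  proof -
    have "0 \<le> s" using that Suc.prems by auto
    then show ?thesis using tanh_ratio_nonneg[of s n] by (smt (verit) mult_nonneg_nonneg)
  qed
  then show ?case using Suc by (auto intro!: continuous_intros)
qed simp

text \<open>The sequence increases and stays below \<open>1 / sqrt s\<close>. Its limit is a
  nonnegative fixed point of the recursion, which means \<open>s * l^2 = 1\<close>.\<close>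

lemma tanh_ratio_tendsto:
  assumes "0 < s" "s < 1"
  shows "(\<lambda>n. tanh_ratio n s) \<longlonglongrightarrow> 1 / sqrt s"
proof -
  have inc: "incseq (\<lambda>n. tanh_ratio n s)"
    using tanh_ratio_less_Suc[OF assms] by (intro incseq_SucI less_imp_le)
  have bd: "tanh_ratio n s \<le> 1 / sqrt s" for n
  proof -
    have "(tanh_ratio n s * sqrt s)\<^sup>2 \<le> 1\<^sup>2"
      using tanh_ratio_square_less[OF assms, of n] assms
      by (simp add: power_mult_distrib mult.commute)
    then have "tanh_ratio n s * sqrt s \<le> 1" by (rule power2_le_imp_le) simp
    then show ?thesis using assms by (simp add: field_simps)
  qed
  then obtain l where l: "(\<lambda>n. tanh_ratio n s) \<longlonglongrightarrow> l" "\<And>n. tanh_ratio n s \<le> l"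
    using incseq_convergent[OF inc, of "1 / sqrt s"] by metis
  have l0: "0 \<le> l" using l(2)[of 0] by simp
  then have nz: "1 + s * l \<noteq> 0" using assms by (smt (verit) mult_nonneg_nonneg)
  have "(\<lambda>n. tanh_ratio (Suc n) s) \<longlonglongrightarrow> (l + 1) / (1 + s * l)"
    unfolding tanh_ratio.simps using l nz by (intro tendsto_intros) auto
  then have "l = (l + 1) / (1 + s * l)" using LIMSEQ_Suc[OF l(1)] LIMSEQ_unique by blast
  then have "l * (1 + s * l) = l + 1" using nz by (simp add: field_simps)
  then have "s * l\<^sup>2 = 1" by (simp add: power2_eq_square algebra_simps)
  then have "(sqrt s * l)\<^sup>2 = 1\<^sup>2" using assms by (simp add: power_mult_distrib)
  then have "sqrt s * l = 1" by (rule power2_eq_imp_eq) (use l0 assms in auto)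
  then have "l = 1 / sqrt s" using assms by (simp add: field_simps)
  then show ?thesis using l by simp
qed

text \<open>Since \<open>(1 + t) / (1 - t) = exp (2 * artanh t)\<close>, the right-hand side is
  \<open>tanh (n * artanh t)\<close>; the induction step is the addition theorem.\<close>

lemma tanh_ratio_closed_form:
  assumes "0 < t" "t < 1"
  shows "tanh_ratio n (t\<^sup>2) * t = (((1+t)/(1-t))^n - 1) / (((1+t)/(1-t))^n + 1)"
proof (induction n)
  case (Suc n)
  define p where "p = ((1+t)/(1-t))^n"
  have p: "p > 0" using assms by (simp add: p_def)
  let ?L = "tanh_ratio n (t\<^sup>2)"
  have L: "?L * t = (p - 1) / (p + 1)" using Suc by (simp add: p_def)
  have "?L \<ge> 0" by (simp add: tanh_ratio_nonneg)
  have eq: "1 + t * (?L * t) = ((1 + t) * p + (1 - t)) / (p + 1)"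
    unfolding L using p by (simp add: field_simps)
  have eq2: "?L * t + t = ((1 + t) * p - (1 - t)) / (p + 1)"
    unfolding L using p by (simp add: field_simps)
  have p1: "(1+t)*p + (1-t) > 0" "p + 1 > 0" using p assms by (auto intro!: add_pos_pos)
  have "tanh_ratio (Suc n) (t\<^sup>2) * t = (?L * t + t) / (1 + t * (?L * t))"
    by (simp add: power2_eq_square algebra_simps)
  also have "\<dots> = ((1 + t) * p - (1 - t)) / ((1 + t) * p + (1 - t))"
    unfolding eq eq2 using p1 by simp
  also have "\<dots> = (((1+t)/(1-t)) * p - 1) / (((1+t)/(1-t)) * p + 1)"
  proof -
    have "((1+t)/(1-t)) * p - 1 = ((1 + t) * p - (1 - t)) / (1 - t)"
         "((1+t)/(1-t)) * p + 1 = ((1 + t) * p + (1 - t)) / (1 - t)"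
      using assms by (simp_all add: field_simps)
    then show ?thesis using assms by simp
  qed
  finally show ?case by (simp add: p_def)
qed simp

text \<open>The roots of this function in \<open>(0, 1/7)\<close> correspond to the solutions \<open>y \<in> (0, 1/2)\<close> of
  \<open>Gn (k - 1) y = y\<close> by \<open>y = (1 - 7 * s) / (2 - 6 * s)\<close>.\<close>

definition crossing :: "nat \<Rightarrow> real \<Rightarrow> real" where
  "crossing k s = tanh_ratio k s - (2 - 6 * s) / (1 - 5 * s)"

text \<open>Strictness comes from the subtracted fraction, whose derivative is
  \<open>4 / (1 - 5 * s)^2\<close>; the other term contributes weak monotonicity.\<close>

lemma crossing_strict_antimono:
  assumes "0 \<le> s" "s < t" "t \<le> 1/7"
  shows "crossing k t < crossing k s"
proof -
  have "(2 - 6 * s) / (1 - 5 * s) < (2 - 6 * t) / (1 - 5 * t)"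
    using assms by (simp add: divide_simps) (simp add: algebra_simps)
  then show ?thesis using tanh_ratio_antimono[of s t k] assms by (simp add: crossing_def)
qed

lemma crossing_root:
  assumes "k \<ge> 3"
  shows "\<exists>!s. s \<in> {0<..<1/7} \<and> crossing k s = 0"
proof -
  \<comment> \<open>The value is \<open>k - 2\<close>, because \<open>tanh_ratio k 0 = k\<close>;
    this is where \<open>k \<ge> 3\<close> enters.\<close>
  have c0: "crossing k 0 > 0" using assms by (simp add: crossing_def tanh_ratio_at_0)
  \<comment> \<open>At \<open>1/7\<close>, which corresponds to \<open>y = 0\<close>, the fraction
    equals 4, while the square of \<open>tanh_ratio\<close> is below 7.\<close>
  have c7: "crossing k (1/7) < 0"
  proof -
    have "(tanh_ratio k (1/7))\<^sup>2 < 4\<^sup>2" using tanh_ratio_square_less[of "1/7" k] by simp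
    then have "tanh_ratio k (1/7) < 4" by (rule power_less_imp_less_base) simp
    then show ?thesis by (simp add: crossing_def)
  qed
  have "continuous_on {0..1/7} (crossing k)"
    unfolding crossing_def
    by (intro continuous_intros continuous_on_tanh_ratio) auto
  then obtain s where s: "0 \<le> s" "s \<le> 1/7" "crossing k s = 0"
    using IVT2'[of "crossing k" "1/7" 0 0] c0 c7 by auto
  have "s \<noteq> 0" "s \<noteq> 1/7" using s(3) c0 c7 by (metis less_irrefl)+
  show ?thesis
  proof (rule ex1I[of _ s])
    show "s \<in> {0<..<1/7} \<and> crossing k s = 0" using s \<open>s \<noteq> 0\<close> \<open>s \<noteq> 1/7\<close> by auto
    fix t assume "t \<in> {0<..<1/7} \<and> crossing k t = 0"
    then show "t = s" using crossing_strict_antimono[of s t k] crossing_strict_antimono[of t s k] s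
      by (cases t s rule: linorder_cases) auto
  qed
qed

definition root_param :: "nat \<Rightarrow> real" where
  "root_param k = (THE s. s \<in> {0<..<1/7} \<and> crossing k s = 0)"

lemma root_param:
  assumes "k \<ge> 3"
  shows "0 < root_param k" "root_param k < 1/7" "crossing k (root_param k) = 0"
  using theI'[OF crossing_root[OF assms]] by (auto simp: root_param_def)

text \<open>Reduces comparison with the root to a sign, from which both the monotonicity in
  \<open>k\<close> and the limit of the root are read off.\<close>

lemma less_root_param_iff:
  assumes "k \<ge> 3" "0 \<le> s" "s \<le> 1/7"
  shows "s < root_param k \<longleftrightarrow> 0 < crossing k s"
  using crossing_strict_antimono[of s "root_param k" k] crossing_strict_antimono[of "root_param k" s k]
    root_param[OF assms(1)] assms by (cases s "root_param k" rule: linorder_cases) auto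

lemma root_param_less_Suc:
  assumes "k \<ge> 3"
  shows "root_param k < root_param (Suc k)"
  using tanh_ratio_less_Suc[of "root_param k" k] root_param[OF assms] assms
  by (subst less_root_param_iff) (auto simp: crossing_def simp del: tanh_ratio.simps)

text \<open>The limit \<open>1 / sqrt s\<close> of \<open>tanh_ratio n s\<close> and the fraction
  \<open>(2 - 6 * s) / (1 - 5 * s)\<close> meet at \<open>s = 1/9\<close>, where both equal
  3.\<close>

lemma root_param_tendsto: "root_param \<longlonglongrightarrow> 1/9"
proof (rule order_tendstoI)
  fix a :: real assume a: "a < 1/9"
  \<comment> \<open>The lower bound \<open>1/10\<close> keeps \<open>s\<close> positive even for
    negative \<open>a\<close>, and it lies below \<open>1/9\<close>.\<close>
  define s where "s = max a (1/10)"
  have s: "0 < s" "s < 1/9" "a \<le> s" using a by (auto simp: s_def)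
  have "3 < 1 / sqrt s"
  proof -
    have "sqrt s < 1/3" using s by (intro real_less_lsqrt) (auto simp: power2_eq_square)
    then show ?thesis using s by (simp add: field_simps)
  qed
  then have "\<forall>\<^sub>F n in sequentially. 3 < tanh_ratio n s"
    using s by (intro order_tendstoD(1)[OF tanh_ratio_tendsto]) auto
  then show "\<forall>\<^sub>F n in sequentially. a < root_param n"
    using eventually_ge_at_top[of 3]
  proof eventually_elim
    case (elim n)
    have "(2 - 6 * s) / (1 - 5 * s) \<le> 3" using s by (simp add: divide_simps)
    then have "0 < crossing n s" using elim by (simp add: crossing_def)
    then show ?case using less_root_param_iff[of n s] elim s by auto
  qed
next
  fix a :: real assume a: "1/9 < a"
  show "\<forall>\<^sub>F n in sequentially. root_param n < a"
    using eventually_ge_at_top[of 3]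
  proof eventually_elim
    case (elim n)
    have "(tanh_ratio n (1/9))\<^sup>2 < 3\<^sup>2" using tanh_ratio_square_less[of "1/9" n] by simp
    then have "tanh_ratio n (1/9) < 3" by (rule power_less_imp_less_base) simp
    then have "\<not> 0 < crossing n (1/9)" by (simp add: crossing_def)
    then show ?case using less_root_param_iff[of n "1/9"] elim a by auto
  qed
qed

section \<open>Closed form of the recursion through its characteristic roots\<close>

locale gn_root_param =
  fixes t y :: real
  assumes t: "0 < t" "t\<^sup>2 < 1/7" and y: "y = (1 - 7 * t\<^sup>2) / (2 - 6 * t\<^sup>2)"
begin

text \<open>This is \<open>exp (2 * artanh t)\<close>, the base of the powers in
  \<open>tanh_ratio_closed_form\<close>. By \<open>rec_coeff\<close> below, \<open>lam\<close> and
  \<open>1 / lam\<close> are the characteristic roots of the recursion for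
  \<open>Gn\<close>.\<close>

definition lam :: real where "lam = (1 + t) / (1 - t)"

lemma t1: "t < 1"
proof -
  have "t\<^sup>2 < 1\<^sup>2" using t by simp
  then show ?thesis by (rule power_less_imp_less_base) simp
qed

lemma lam_gt_1: "1 < lam"
  using t t1 by (simp add: lam_def field_simps)

lemma t2: "0 < 2 - 6 * t\<^sup>2" "0 < 1 - t\<^sup>2" using t by auto

lemma lam_sum: "lam + 1 / lam = 2 * (1 + t\<^sup>2) / (1 - t\<^sup>2)"
  and lam_diff: "lam - 1 / lam = 4 * t / (1 - t\<^sup>2)"
proof -
  have e: "1 - t\<^sup>2 = (1 - t) * (1 + t)" by (simp add: power2_eq_square algebra_simps)
  have i: "1 / lam = (1 - t) / (1 + t)" by (simp add: lam_def)
  show "lam + 1 / lam = 2 * (1 + t\<^sup>2) / (1 - t\<^sup>2)" "lam - 1 / lam = 4 * t / (1 - t\<^sup>2)"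
    unfolding e i lam_def using t t1 by (simp_all add: divide_simps power2_eq_square) (simp_all add: algebra_simps)
qed

lemma G0_eq: "Gn 0 y = (1 - 5 * t\<^sup>2) / (2 - 6 * t\<^sup>2)"
  and three_minus: "3 - 2 * y = 4 * (1 - t\<^sup>2) / (2 - 6 * t\<^sup>2)"
  and one_minus: "1 - y = (1 + t\<^sup>2) / (2 - 6 * t\<^sup>2)"
  using t2 by (simp_all add: y divide_simps) (simp_all add: algebra_simps)

lemma rec_coeff: "8 * (1 - y) / (3 - 2 * y) = lam + 1 / lam"
  proof -
  have red: "8 * (a / d) / (4 * b / d) = 2 * a / b" if "d \<noteq> 0" "b \<noteq> 0" for a b d :: real
    using that by (simp add: field_simps)
  show ?thesis unfolding lam_sum three_minus one_minus by (intro red) (use t2 in auto)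
qed

text \<open>The coefficients \<open>cA\<close> and \<open>cB\<close> are fitted to the initial
  values \<open>Gn 0 y\<close> and \<open>Gn 1 y = y\<close>.\<close>

definition cA :: real where "cA = (y - Gn 0 y / lam) / (lam - 1 / lam)"
definition cB :: real where "cB = (Gn 0 y * lam - y) / (lam - 1 / lam)"

lemma lam_diff_pos: "0 < lam - 1 / lam"
  using lam_gt_1 by (simp add: field_simps less_1_mult)

lemma cA_plus_cB: "cA + cB = Gn 0 y"
proof -
  have "cA + cB = (Gn 0 y * (lam - 1 / lam)) / (lam - 1 / lam)"
    unfolding cA_def cB_def add_divide_distrib[symmetric]
    by (simp add: algebra_simps del: Gn.simps)
  then show ?thesis using lam_diff_pos by simp
qed

lemma Gn_closed_form: "Gn n y = cA * lam ^ n + cB / lam ^ n"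
proof (induction n rule: induct_nat_012)
  case 0
  show ?case using cA_plus_cB by simp
next
  case 1
  have "cA * lam + cB / lam = ((y - Gn 0 y / lam) * lam + (Gn 0 y * lam - y) / lam) / (lam - 1 / lam)"
    unfolding cA_def cB_def by (simp add: add_divide_distrib mult.commute del: Gn.simps)
  also have "(y - Gn 0 y / lam) * lam + (Gn 0 y * lam - y) / lam = y * (lam - 1 / lam)"
    using lam_gt_1 by (simp add: field_simps del: Gn.simps)
  finally have "cA * lam + cB / lam = (y * (lam - 1 / lam)) / (lam - 1 / lam)" .
  then show ?case using lam_diff_pos by simp
next
  case (ge2 n)
  have "Gn (Suc (Suc n)) y = (lam + 1 / lam) * (cA * lam ^ Suc n + cB / lam ^ Suc n) - (cA * lam ^ n + cB / lam ^ n)"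
    using ge2 by (simp only: Gn.simps rec_coeff)
  also have "\<dots> = cA * lam ^ Suc (Suc n) + cB / lam ^ Suc (Suc n)"
    using lam_gt_1 by (simp add: field_simps)
  finally show ?case .
qed

text \<open>As \<open>Gn 1 y = y\<close>, the equation compares the closed form at
  \<open>k - 1\<close> and at 1. The difference contains the factor
  \<open>lam ^ (k - 2) - 1\<close>, which is nonzero; what remains is the condition that makes
  \<open>Gn n y\<close> symmetric under \<open>n \<mapsto> k - n\<close>.\<close>

lemma Gn_eq_iff_cB:
  assumes "k \<ge> 3"
  shows "Gn (k - 1) y = y \<longleftrightarrow> cB = cA * lam ^ k"
proof -
  obtain j where k: "k = Suc (Suc (Suc j))" using assms by (metis numeral_3_eq_3 le_Suc_ex add_Suc)
  have "lam ^ Suc j > 1" using lam_gt_1 by (simp add: one_less_power del: power_Suc)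
  have "Gn (k - 1) y - y = cA * lam ^ Suc (Suc j) + cB / lam ^ Suc (Suc j) - (cA * lam + cB / lam)"
    using Gn_closed_form[of "k - 1"] Gn_closed_form[of 1] by (simp add: k)
  also have "\<dots> = (lam ^ Suc j - 1) * (cA * lam ^ k - cB) / lam ^ Suc (Suc j)"
    using lam_gt_1 by (simp add: k field_simps)
  finally show ?thesis using \<open>lam ^ Suc j > 1\<close> lam_gt_1 by auto
qed

lemma cB_minus_cA: "2 * t * (cB - cA) = Gn 0 y * (1 + t\<^sup>2) - y * (1 - t\<^sup>2)"
proof -
  have "cB - cA = (Gn 0 y * (lam + 1 / lam) - 2 * y) / (lam - 1 / lam)"
    unfolding cA_def cB_def diff_divide_distrib[symmetric]
    by (simp add: algebra_simps del: Gn.simps)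
  also have "\<dots> = (Gn 0 y * (2 * (1 + t\<^sup>2) / (1 - t\<^sup>2)) - 2 * y) / (4 * t / (1 - t\<^sup>2))"
    unfolding lam_sum lam_diff ..
  also have "\<dots> = (Gn 0 y * (1 + t\<^sup>2) - y * (1 - t\<^sup>2)) / (2 * t)"
    using t t2 by (simp add: divide_simps) (simp add: algebra_simps)
  finally show ?thesis using t by simp
qed

text \<open>The condition \<open>cB = cA * lam ^ k\<close> says that
  \<open>(cB - cA) / (cB + cA)\<close> equals \<open>(lam ^ k - 1) / (lam ^ k + 1)\<close>, that is
  \<open>L * t\<close>. Expressing \<open>cB - cA\<close> and \<open>cA + cB\<close> through
  \<open>t\<close> leaves the equation for \<open>crossing\<close>.\<close>

lemma Gn_eq_iff:
  assumes "k \<ge> 3"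
  shows "Gn (k - 1) y = y \<longleftrightarrow> crossing k (t\<^sup>2) = 0"
proof -
  define L where "L = tanh_ratio k (t\<^sup>2)"
  have p: "lam ^ k > 0" using lam_gt_1 by simp
  have L: "L * t * (lam ^ k + 1) = lam ^ k - 1"
    using tanh_ratio_closed_form[OF t(1) t1, of k] p unfolding L_def lam_def[symmetric] by simp
  have "Gn (k - 1) y = y \<longleftrightarrow> (cA + cB) * (lam ^ k - 1) = (cB - cA) * (lam ^ k + 1)"
    unfolding Gn_eq_iff_cB[OF assms] by (auto simp: algebra_simps)
  also have "\<dots> \<longleftrightarrow> (cA + cB) * (L * t) = cB - cA"
  proof -
    have "(cA + cB) * (lam ^ k - 1) = (cA + cB) * (L * t) * (lam ^ k + 1)" using L by (simp add: mult.assoc)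
    then show ?thesis using p by (metis add_pos_pos less_irrefl mult_right_cancel zero_less_one)
  qed
  also have "\<dots> \<longleftrightarrow> 2 * t * ((cA + cB) * (L * t)) = 2 * t * (cB - cA)" using t by simp
  also have "\<dots> \<longleftrightarrow> 2 * t\<^sup>2 * L * Gn 0 y = Gn 0 y * (1 + t\<^sup>2) - y * (1 - t\<^sup>2)"
    unfolding cB_minus_cA cA_plus_cB by (simp add: power2_eq_square algebra_simps)
  also have "\<dots> \<longleftrightarrow> 2 * t\<^sup>2 * L * (1 - 5 * t\<^sup>2) = (1 - 5 * t\<^sup>2) * (1 + t\<^sup>2) - (1 - 7 * t\<^sup>2) * (1 - t\<^sup>2)"
    unfolding G0_eq unfolding y using t2 by (simp add: divide_simps)
  \<comment> \<open>The right-hand side expands to \<open>4 * t^2 - 12 * t^4\<close>, so that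
    \<open>2 * t^2\<close> becomes a common factor.\<close>
  also have "\<dots> \<longleftrightarrow> 2 * t\<^sup>2 * (L * (1 - 5 * t\<^sup>2)) = 2 * t\<^sup>2 * (2 - 6 * t\<^sup>2)"
    by (simp add: algebra_simps)
  also have "\<dots> \<longleftrightarrow> L * (1 - 5 * t\<^sup>2) = 2 - 6 * t\<^sup>2" using t by simp
  also have "\<dots> \<longleftrightarrow> crossing k (t\<^sup>2) = 0" using t by (simp add: crossing_def L_def field_simps)
  finally show ?thesis .
qed

lemma Gn_symmetric_form:
  assumes "k \<ge> 3" "Gn (k - 1) y = y" "n \<le> k"
  shows "Gn n y = cA * (lam ^ n + lam ^ (k - n))"
proof -
  have "cB = cA * lam ^ k" using Gn_eq_iff_cB[OF assms(1)] assms(2) by blast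
  then show ?thesis using assms(3) lam_gt_1 by (simp add: Gn_closed_form power_diff field_simps)
qed

lemma cA_pos:
  assumes "k \<ge> 3" "Gn (k - 1) y = y"
  shows "cA > 0"
proof -
  have "cA * (1 + lam ^ k) > 0"
    using Gn_symmetric_form[OF assms, of 0] G0_eq t t2 by simp
  moreover have "1 + lam ^ k > 0" using lam_gt_1 by (simp add: add_pos_pos)
  ultimately show ?thesis by (simp add: zero_less_mult_iff)
qed

end

text \<open>The map \<open>y \<mapsto> (1 - 2 * y) / (7 - 6 * y)\<close> is inverse to
  \<open>s \<mapsto> (1 - 7 * s) / (2 - 6 * s)\<close> and carries \<open>(0, 1/2)\<close> into
  \<open>(0, 1/7)\<close>.\<close>

lemma gn_root_paramI:
  assumes "0 < y" "y < 1/2"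
  shows "gn_root_param (sqrt ((1 - 2 * y) / (7 - 6 * y))) y"
proof
  define s where "s = (1 - 2 * y) / (7 - 6 * y)"
  have s: "0 < s" "s < 1/7" using assms by (auto simp: s_def divide_simps)
  then show "0 < sqrt s" "(sqrt s)\<^sup>2 < 1/7" by auto
  have "2 - 6 * s = 8 / (7 - 6 * y)" "1 - 7 * s = 8 * y / (7 - 6 * y)"
    using assms by (simp_all add: s_def divide_simps)
  then show "y = (1 - 7 * (sqrt s)\<^sup>2) / (2 - 6 * (sqrt s)\<^sup>2)" using s assms by simp
qed

context
  fixes k :: nat and y :: real
  assumes k: "k \<ge> 3" and y01: "0 < y" "y < 1/2" and root: "Gn (k - 1) y = y"
begin

interpretation gn_root_param "sqrt ((1 - 2 * y) / (7 - 6 * y))" y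
  by (rule gn_root_paramI[OF y01])

lemma Gn_pos: "n \<le> k \<Longrightarrow> 0 < Gn n y"
  using Gn_symmetric_form[OF k root, of n] cA_pos[OF k root] lam_gt_1 by (simp add: add_pos_pos)

lemma Gn_symmetric: "n \<le> k \<Longrightarrow> Gn (k - n) y = Gn n y"
  using Gn_symmetric_form[OF k root, of n] Gn_symmetric_form[OF k root, of "k - n"] by simp

text \<open>Summing the recursion over \<open>1..k-1\<close> gives
  \<open>(c - 2) * S = 2 * (Gn 0 y - y)\<close>, the boundary terms being known by symmetry. The
  value \<open>Gn 0 y = 1/4 + y/2\<close> then makes all weights sum to 1.\<close>

lemma sum_Gn: "(\<Sum>n=1..k-1. Gn n y) = 1 - Gn 0 y"
proof -
  define c where "c = 8 * (1 - y) / (3 - 2 * y)"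
  define S where "S = (\<Sum>n=1..k-1. Gn n y)"
  have rec: "Gn (Suc n) y + Gn (n - 1) y = c * Gn n y" if "n \<ge> 1" for n
    using that by (cases n) (auto simp: c_def)
  have up: "(\<Sum>n=1..m. Gn (Suc n) y) = (\<Sum>n=1..m. Gn n y) - Gn 1 y + Gn (Suc m) y" for m
    by (induction m) (auto simp del: Gn.simps)
  have down: "(\<Sum>n=1..m. Gn (n - 1) y) = (\<Sum>n=1..m. Gn n y) - Gn m y + Gn 0 y" for m
    by (induction m) (auto simp del: Gn.simps)
  have "c * S = (\<Sum>n=1..k-1. Gn (Suc n) y + Gn (n - 1) y)"
    unfolding S_def sum_distrib_left using rec by (intro sum.cong) auto
  also have "\<dots> = 2 * S - Gn 1 y - Gn (k - 1) y + Gn k y + Gn 0 y"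
    unfolding sum.distrib up down S_def using k by (simp del: Gn.simps)
  finally have "(c - 2) * S = 2 * (Gn 0 y - y)"
    using root Gn_symmetric[of 0] by (simp add: algebra_simps del: Gn.simps(1,3))
  moreover have "c - 2 = (2 - 4 * y) / (3 - 2 * y)" using y01 by (simp add: c_def divide_simps)
  ultimately have "S * (2 - 4 * y) = 2 * (Gn 0 y - y) * (3 - 2 * y)" using y01 by (simp add: field_simps)
  also have "\<dots> = (1 - Gn 0 y) * (2 - 4 * y)" by (simp add: algebra_simps)
  finally show ?thesis using y01 by (simp add: S_def)
qed

end

section \<open>The solution and its dependence on \<open>k\<close>\<close>

lemma Gn_root_unique:
  assumes "k \<ge> 3"
  shows "y \<in> {0<..<1/2} \<and> Gn (k - 1) y = y \<longleftrightarrow> y = (1 - 7 * root_param k) / (2 - 6 * root_param k)"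
    (is "_ \<longleftrightarrow> y = ?z")
proof
  assume root: "y \<in> {0<..<1/2} \<and> Gn (k - 1) y = y"
  define s where "s = (1 - 2 * y) / (7 - 6 * y)"
  have s: "0 < s" "s < 1/7" using root by (auto simp: s_def divide_simps)
  interpret gn_root_param "sqrt s" y unfolding s_def using root by (intro gn_root_paramI) auto
  have "(sqrt s)\<^sup>2 = s" using s by simp
  then have "crossing k s = 0" using Gn_eq_iff[OF assms] root by metis
  then have "s = root_param k" using crossing_root[OF assms] root_param[OF assms] s by auto
  moreover have "y = (1 - 7 * s) / (2 - 6 * s)"
    using y \<open>(sqrt s)\<^sup>2 = s\<close> by simp
  ultimately show "y = ?z" by simp
next
  assume z: "y = ?z"
  let ?s = "root_param k"
  note s = root_param[OF assms]
  interpret gn_root_param "sqrt ?s" y using s z by unfold_locales auto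
  have "Gn (k - 1) y = y" using Gn_eq_iff[OF assms] s by (simp del: One_nat_def)
  then show "y \<in> {0<..<1/2} \<and> Gn (k - 1) y = y" using s by (simp add: z divide_simps)
qed

lemma ex1_Gn_root: "k \<ge> 3 \<Longrightarrow> \<exists>!y. y \<in> {0<..<1/2} \<and> Gn (k - 1) y = y"
  by (simp only: Gn_root_unique) blast

lemma yk_eq: "k \<ge> 3 \<Longrightarrow> yk k = (1 - 7 * root_param k) / (2 - 6 * root_param k)"
  unfolding yk_def by (simp only: Gn_root_unique the_eq_trivial)

lemma yk:
  assumes "k \<ge> 3"
  shows "0 < yk k" "yk k < 1/2" "Gn (k - 1) (yk k) = yk k"
  using Gn_root_unique[OF assms, of "yk k"] yk_eq[OF assms] by auto

text \<open>The solution \<open>y\<close> is a decreasing function of \<open>s\<close>, and the root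
  \<open>s\<close> increases with \<open>k\<close>.\<close>

lemma yk_strict_antimono:
  assumes "3 \<le> j" "j < k"
  shows "yk k < yk j"
proof -
  have step: "yk (Suc n) < yk n" if "n \<ge> 3" for n
    using root_param_less_Suc[OF that] root_param[OF that] root_param[of "Suc n"] that
    by (simp add: yk_eq divide_simps) (simp add: algebra_simps)
  from assms(2,1) show ?thesis
    by (induction rule: less_Suc_induct) (auto intro: step)
qed

lemma yk_tendsto: "yk \<longlonglongrightarrow> 1/6"
proof -
  have "(\<lambda>k. (1 - 7 * root_param k) / (2 - 6 * root_param k)) \<longlonglongrightarrow> (1 - 7 * (1/9)) / (2 - 6 * (1/9))"
    by (intro tendsto_intros root_param_tendsto) auto
  moreover have "\<forall>\<^sub>F k in sequentially. (1 - 7 * root_param k) / (2 - 6 * root_param k) = yk k"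
    using eventually_ge_at_top[of 3] by eventually_elim (simp add: yk_eq)
  ultimately show ?thesis using tendsto_cong by fastforce
qed

section \<open>Words and right multiplication\<close>

abbreviation words :: "nat \<Rightarrow> (int + int) list set" where
  "words k \<equiv> normal_words (integer_mod_group 2) (integer_mod_group k)"

abbreviation word_mult :: "nat \<Rightarrow> (int + int) list \<Rightarrow> (int + int) list \<Rightarrow> (int + int) list" where
  "word_mult k \<equiv> foldr (letter_mult (integer_mod_group 2) (integer_mod_group k))"

lemma letters_Z2_Zk:
  "k > 0 \<Longrightarrow> letters (integer_mod_group 2) (integer_mod_group k) = {Inl 1} \<union> Inr ` {1..<int k}"
  by (auto simp: letters_def carrier_integer_mod_group image_iff)

text \<open>For \<open>g\<close> in \<open>b_open k\<close>, the word \<open>b_power k g j\<close> is the product of \<open>g\<close> and \<open>b ^ j\<close>.\<close>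

definition b_open :: "nat \<Rightarrow> (int + int) list set" where
  "b_open k = {g \<in> words k. g = [] \<or> isl (last g)}"

definition b_power :: "nat \<Rightarrow> (int + int) list \<Rightarrow> int \<Rightarrow> (int + int) list" where
  "b_power k g j = (if j mod int k = 0 then g else g @ [Inr (j mod int k)])"

lemma words_snoc:
  "g @ [u] \<in> words k \<longleftrightarrow>
     g \<in> words k \<and> u \<in> letters (integer_mod_group 2) (integer_mod_group k) \<and> (g = [] \<or> isl u \<noteq> isl (last g))"
  by (auto simp: normal_words_def successively_append_iff)

context
  fixes k :: nat
  assumes k: "k \<ge> 3"
begin

text \<open>Every coset of the subgroup generated by \<open>b\<close> contains some \<open>g\<close>
  in \<open>b_open k\<close>. In these coordinates right multiplication by a power of
  \<open>b\<close> is a shift of \<open>j\<close>.\<close>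

lemma words_cases:
  assumes "w \<in> words k"
  obtains g j where "g \<in> b_open k" "w = b_power k g j"
proof (cases "w = [] \<or> isl (last w)")
  case True
  then show ?thesis using assms that[of w 0] by (auto simp: b_open_def b_power_def)
next
  case False
  then obtain g j where w: "w = g @ [Inr j]" by (cases w rule: rev_cases; cases "last w") auto
  then have "g \<in> b_open k" "j \<in> {1..<int k}"
    using assms k by (auto simp: words_snoc b_open_def letters_Z2_Zk)
  then show ?thesis using that[of g j] w by (auto simp: b_power_def)
qed

lemma b_power_in_words: "g \<in> b_open k \<Longrightarrow> b_power k g j \<in> words k"
  using k pos_mod_bound[of "int k" j] pos_mod_sign[of "int k" j]
  by (auto simp: b_power_def b_open_def words_snoc letters_Z2_Zk simp del: pos_mod_bound pos_mod_sign)

lemma word_mult_eq_append: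
  assumes "g @ z \<in> words k"
  shows "word_mult k g z = g @ z"
  using assms
proof (induction g)
  case (Cons u g)
  then have "word_mult k g z = g @ z" by (simp add: normal_words_Cons)
  then show ?case
    using Cons.prems by (cases u; cases "g @ z"; cases "hd (g @ z)") (auto simp: normal_words_Cons)
qed simp

lemma word_mult_snoc_Inr:
  assumes "g \<in> b_open k" "i \<in> {1..<int k}" "j \<in> {1..<int k}"
  shows "word_mult k (g @ [Inr i]) [Inr j] = b_power k g (i + j)"
proof -
  have "b_power k g (i + j) \<in> words k" using assms by (intro b_power_in_words)
  then show ?thesis using word_mult_eq_append[of g]
    by (auto simp: b_power_def split: if_splits)
qed

lemma word_mult_b_power:
  assumes "g \<in> b_open k" "j \<in> {1..<int k}"
  shows "word_mult k (b_power k g i) [Inr j] = b_power k g (i + j)"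
proof (cases "i mod int k = 0")
  case True
  then have "(i + j) mod int k = j" using assms(2) by (metis add_0 atLeastLessThan_iff int_one_le_iff_zero_less less_imp_le mod_add_left_eq mod_pos_pos_trivial)
  then have *: "b_power k g (i + j) = g @ [Inr j]" using assms(2) by (simp add: b_power_def)
  then show ?thesis using True b_power_in_words[OF assms(1), of "i + j"]
    by (simp add: b_power_def[of k g i] word_mult_eq_append)
next
  case False
  then have "i mod int k \<in> {1..<int k}"
    using k pos_mod_bound[of "int k" i] pos_mod_sign[of "int k" i] by (auto simp del: pos_mod_bound pos_mod_sign)
  then have "word_mult k (b_power k g i) [Inr j] = b_power k g (i mod int k + j)"
    using False word_mult_snoc_Inr[OF assms(1) _ assms(2)] by (simp add: b_power_def[of k g i])
  then show ?thesis by (simp add: b_power_def mod_add_left_eq)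
qed

lemma word_mult_a:
  assumes "w \<in> words k" "w = [] \<or> \<not> isl (last w)"
  shows "w @ [Inl 1] \<in> words k" "word_mult k w [Inl 1] = w @ [Inl 1]"
proof -
  show "w @ [Inl 1] \<in> words k" using assms k by (auto simp: words_snoc letters_Z2_Zk)
  then show "word_mult k w [Inl 1] = w @ [Inl 1]" by (rule word_mult_eq_append)
qed

lemma words_ends_a:
  assumes "w \<in> words k" "w \<noteq> []" "isl (last w)"
  obtains g where "w = g @ [Inl 1]" "g \<in> words k" "g = [] \<or> \<not> isl (last g)" "word_mult k w [Inl 1] = g"
proof -
  obtain g u where w: "w = g @ [Inl u]" using assms(2,3) by (cases w rule: rev_cases; cases "last w") auto
  then have g: "u = 1" "g \<in> words k" "g = [] \<or> \<not> isl (last g)"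
    using assms k by (auto simp: words_snoc letters_Z2_Zk)
  moreover have "word_mult k (g @ [Inl 1]) [Inl 1] = g"
    using word_mult_eq_append[of g "[]"] g by simp
  ultimately show ?thesis using that w by simp
qed

lemma inv_gen_b: "inv\<^bsub>Z2_Zk k\<^esub> gen_b = [Inr (int k - 1)]"
proof (rule group.inv_equality[OF group_free_product])
  show "[Inr (int k - 1)] \<otimes>\<^bsub>Z2_Zk k\<^esub> gen_b = \<one>\<^bsub>Z2_Zk k\<^esub>" by simp
qed (use k in \<open>auto simp: normal_words_Cons carrier_integer_mod_group\<close>)

end

section \<open>Potentials of the stationary measure\<close>

locale letter_weights =
  fixes k :: nat and y :: real
  assumes k: "k \<ge> 3" and y: "0 < y" "y < 1/2" and root: "Gn (k - 1) y = y"
begin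

definition rho :: "int \<Rightarrow> real" where "rho m = Gn (nat (m mod int k)) y"

abbreviation r :: real where "r \<equiv> rho 0"

lemma rho_0: "r = 1/4 + y/2" using k by (simp add: rho_def)
lemma rho_1: "rho 1 = y" using k by (simp add: rho_def)
lemma r_less_1: "0 < r" "r < 1" "4 * r = 1 + 2 * y" using y by (simp_all add: rho_0)

lemma rho_mod [simp]: "rho (m mod int k) = rho m"
  by (simp add: rho_def)

lemma rho_cong: "m mod int k = n mod int k \<Longrightarrow> rho m = rho n"
  by (simp add: rho_def)

lemma rho_period: "rho (m + int k) = rho m"
  by (simp add: rho_def)

lemma rho_nat: "n < k \<Longrightarrow> rho (int n) = Gn n y"
  by (simp add: rho_def)

lemma mod_range: "0 \<le> m mod int k" "m mod int k < int k"
  using k by auto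

lemma rho_pos: "0 < rho m"
  unfolding rho_def using mod_range[of m] by (intro Gn_pos[OF k y root]) linarith

lemma rho_uminus: "rho (- m) = rho m"
proof (cases "m mod int k = 0")
  case True
  then show ?thesis by (intro rho_cong) (simp add: zmod_zminus1_eq_if)
next
  case False
  then have "nat (- m mod int k) = k - nat (m mod int k)"
    using mod_range[of m] by (simp add: zmod_zminus1_eq_if nat_diff_distrib)
  then show ?thesis using Gn_symmetric[OF k y root, of "nat (m mod int k)"] mod_range[of m]
    by (simp add: rho_def)
qed

definition cc :: real where "cc = 8 * (1 - y) / (3 - 2 * y)"

text \<open>In this form the recursion coefficient combines with \<open>1 - r\<close>, the total
  weight of the powers of \<open>b\<close>.\<close>

lemma cc_eq: "cc * (1 - r) = 3 - 4 * r"
  using y unfolding cc_def rho_0 by (simp add: field_simps)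

text \<open>At residue \<open>k - 1\<close> the recursion produces \<open>Gn k y\<close>, which
  equals \<open>Gn 0 y\<close> by symmetry, so it closes up periodically. Residue 0 is treated
  separately in \<open>rho_rec_0\<close>.\<close>

lemma rho_rec:
  assumes "m mod int k \<noteq> 0"
  shows "rho (m + 1) + rho (m - 1) = cc * rho m"
proof -
  define n where "n = nat (m mod int k)"
  have n: "m mod int k = int n" "0 < n" "n < k" using assms mod_range[of m] by (auto simp: n_def)
  have "rho (m + 1) = Gn (Suc n) y"
  proof (cases "Suc n = k")
    case True
    have "(m + 1) mod int k = 0" using n True by (metis add.commute mod_add_left_eq mod_self of_nat_Suc)
    then show ?thesis using True Gn_symmetric[OF k y root, of 0] by (simp add: rho_def)
  next
    case False
    have "(m + 1) mod int k = (int n + 1) mod int k" using n by (metis mod_add_left_eq)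
    also have "\<dots> = int (Suc n)" using False n by simp
    finally show ?thesis unfolding rho_def by (simp del: of_nat_Suc)
  qed
  moreover have "rho (m - 1) = Gn (n - 1) y"
  proof -
    have "(m - 1) mod int k = (int n - 1) mod int k" using n by (metis mod_diff_left_eq)
    also have "\<dots> = int (n - 1)" using n by (simp add: of_nat_diff)
    finally show ?thesis unfolding rho_def by simp
  qed
  moreover have "rho m = Gn n y" by (simp add: rho_def n)
  moreover have "Gn (Suc n) y + Gn (n - 1) y = cc * Gn n y" using n by (cases n) (auto simp: cc_def)
  ultimately show ?thesis by simp
qed

lemma rho_rec_0:
  assumes "m mod int k = 0"
  shows "rho (m + 1) = y" "rho (m - 1) = y"
proof -
  have "(m + 1) mod int k = 1 mod int k" "(m - 1) mod int k = - 1 mod int k"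
    using assms by (metis add_0 mod_add_left_eq, metis diff_0 mod_diff_left_eq)
  then have "rho (m + 1) = rho 1" "rho (m - 1) = rho (- 1)" by (blast intro: rho_cong)+
  then show "rho (m + 1) = y" "rho (m - 1) = y" using rho_1 rho_uminus[of 1] by auto
qed

lemma sum_rho: "(\<Sum>i\<in>{1..<int k}. rho i) = 1 - r"
proof -
  have "(\<Sum>i\<in>{1..<int k}. rho i) = (\<Sum>n=1..k-1. Gn n y)"
    by (rule sum.reindex_bij_witness[of _ int nat]) (use k in \<open>auto simp: rho_def\<close>)
  then show ?thesis using sum_Gn[OF k y root] rho_0 by simp
qed

lemma split_0: "(\<Sum>i\<in>{0..<int k}. f i) = f 0 + (\<Sum>i\<in>{1..<int k}. f i)" for f :: "int \<Rightarrow> real"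
proof -
  have "{0..<int k} = insert 0 {1..<int k}" using k by auto
  then show ?thesis by simp
qed

lemma sum_rho_shift_all: "(\<Sum>i\<in>{0..<int k}. rho (i - j)) = 1"
proof -
  have "(\<Sum>i\<in>{0..<int k}. rho (i - j)) = (\<Sum>i\<in>{0..<int k}. rho i)"
  proof (rule sum.reindex_bij_witness[of _ "\<lambda>i. (i + j) mod int k" "\<lambda>i. (i - j) mod int k"])
    fix a assume a: "a \<in> {0..<int k}"
    show "((a - j) mod int k + j) mod int k = a" "((a + j) mod int k - j) mod int k = a"
      using a by (simp_all add: mod_add_left_eq mod_diff_left_eq)
  qed (use mod_range in auto)
  then show ?thesis using sum_rho by (simp add: split_0)
qed

lemma sum_rho_shift: "(\<Sum>i\<in>{1..<int k}. rho (i - j)) = 1 - rho j"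
  using sum_rho_shift_all[of j] rho_uminus[of j] by (simp add: split_0)

context
  fixes B :: "(int + int) list \<Rightarrow> real" and d :: real
begin

text \<open>
  Suppose \<open>f\<close> is a function of \<open>g \<xi>\<close> (for \<open>d = 0\<close>), or of \<open>g \<xi>\<close> compared to \<open>\<xi>\<close> and lowered by
  \<open>d\<close> for each letter of \<open>\<xi>\<close> that is consumed. If \<open>B g\<close> is its mean given that \<open>g\<close> and \<open>\<xi>\<close> meet
  without interaction, then \<open>conditional (rev g)\<close> is the pair of its means given that the first
  letter of \<open>\<xi>\<close> is \<open>a\<close>, and given that it is a power of \<open>b\<close>. The word is reversed because the
  cancellation starts at the last letter of \<open>g\<close>.
\<close>

primrec conditional :: "(int + int) list \<Rightarrow> real \<times> real" where
  "conditional [] = (B [Inl 1] - d, (\<Sum>i\<in>{1..<int k}. rho i / (1 - r) * B [Inr i]) - d)"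
| "conditional (u # z) =
    (case u of
       Inl _ \<Rightarrow> (snd (conditional z) - d,
                  (\<Sum>i\<in>{1..<int k}. rho i / (1 - r) * B (rev z @ [u, Inr i])) - d)
     | Inr j \<Rightarrow> (B (rev z @ [u, Inl 1]) - d,
                  (rho j * (fst (conditional z) - d)
                    + (\<Sum>i\<in>{1..<int k} - {j}. rho (i - j) * (B (rev z @ [Inr i]) - d))) / (1 - r)))"

definition Va :: "(int + int) list \<Rightarrow> real" where "Va g = fst (conditional (rev g))"
definition Vb :: "(int + int) list \<Rightarrow> real" where "Vb g = snd (conditional (rev g))"
definition potential :: "(int + int) list \<Rightarrow> real" where
  "potential g = r * Va g + (1 - r) * Vb g"

lemma Va_snoc_Inl: "Va (g @ [Inl u]) = Vb g - d"
  by (simp add: Va_def Vb_def)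

lemma Va_open: "g = [] \<or> \<not> isl (last g) \<Longrightarrow> Va g = B (g @ [Inl 1]) - d"
  by (cases g rule: rev_cases) (auto simp: Va_def split: sum.splits)

lemma Vb_open: "g = [] \<or> isl (last g) \<Longrightarrow> Vb g = (\<Sum>i\<in>{1..<int k}. rho i / (1 - r) * B (g @ [Inr i])) - d"
  by (cases g rule: rev_cases) (auto simp: Vb_def split: sum.splits)

text \<open>A first letter \<open>b ^ l\<close> of \<xi> turns the final \<open>b ^ j\<close> into
  \<open>b ^ i\<close> with \<open>l = i - j\<close>. The case \<open>i = j\<close> would mean
  \<open>l = 0\<close> and is left out. The case \<open>i = 0\<close> is full cancellation: it has
  weight \<open>rho (- j) = rho j\<close>, and the rest of \<xi> then meets \<open>g\<close> with
  first letter \<open>a\<close>.\<close>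

lemma Vb_snoc_Inr:
  "Vb (g @ [Inr j]) = (rho j * (Va g - d)
      + (\<Sum>i\<in>{1..<int k} - {j}. rho (i - j) * (B (g @ [Inr i]) - d))) / (1 - r)"
  by (simp add: Va_def Vb_def)

lemma b_open_Vb:
  assumes "g \<in> b_open k"
  shows "(1 - r) * (Vb g + d) = (\<Sum>i\<in>{1..<int k}. rho i * B (g @ [Inr i]))"
proof -
  have "Vb g + d = (\<Sum>i\<in>{1..<int k}. rho i * B (g @ [Inr i])) / (1 - r)"
    using Vb_open[of g] assms by (auto simp: b_open_def sum_divide_distrib)
  then show ?thesis using r_less_1 by simp
qed

context
  assumes B_a: "\<And>g. g \<in> words k \<Longrightarrow> g \<noteq> [] \<Longrightarrow> \<not> isl (last g) \<Longrightarrow> B g = B (g @ [Inl 1]) - d"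
    and B_b: "\<And>g. g \<in> words k \<Longrightarrow> g \<noteq> [] \<Longrightarrow> isl (last g) \<Longrightarrow>
      B g = (\<Sum>i\<in>{1..<int k}. rho i / (1 - r) * B (g @ [Inr i])) - d"
begin

text \<open>On a coset of the powers of \<open>b\<close> the potential depends on \<open>j\<close>
  only through the arguments of \<open>rho\<close>. The formula is uniform in \<open>j\<close>,
  multiples of \<open>k\<close> included, so a step by \<open>b\<close> or its inverse merely shifts
  these arguments.\<close>

lemma potential_b_power:
  assumes g: "g \<in> b_open k"
  shows "potential (b_power k g j) =
    rho j * Va g + (\<Sum>i\<in>{1..<int k}. rho (i - j) * B (g @ [Inr i])) - d * (1 - r)"
proof (cases "j mod int k = 0")
  case True
  then have "rho (i - j) = rho i" for i by (intro rho_cong) (simp add: mod_diff_eq[symmetric])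
  moreover have "rho j = r" using True by (intro rho_cong) simp
  ultimately show ?thesis
    using True b_open_Vb[OF g] by (simp add: b_power_def potential_def algebra_simps)
next
  case False
  define m where "m = j mod int k"
  have m: "m \<in> {1..<int k}" using mod_range[of j] False by (auto simp: m_def)
  have jm: "rho j = rho m" "rho (i - j) = rho (i - m)" for i
    by (auto simp: m_def intro!: rho_cong simp: mod_diff_right_eq)
  let ?w = "g @ [Inr m]"
  have w: "b_power k g j = ?w" using False by (simp add: b_power_def m_def)
  then have "?w \<in> words k" using b_power_in_words[OF k g, of j] by simp
  then have Va: "Va ?w = B ?w" using Va_open[of ?w] B_a[of ?w] by simp
  have e: "(\<Sum>i\<in>{1..<int k}. f i) = f m + (\<Sum>i\<in>{1..<int k} - {m}. f i)" for f :: "int \<Rightarrow> real"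
    using m by (simp add: sum.remove)
  have s: "(\<Sum>i\<in>{1..<int k} - {m}. rho (i - m)) = 1 - rho m - r"
    using sum_rho_shift[of m] e[of "\<lambda>i. rho (i - m)"] by simp
  have "(1 - r) * Vb ?w = rho m * (Va g - d) + (\<Sum>i\<in>{1..<int k} - {m}. rho (i - m) * (B (g @ [Inr i]) - d))"
    using r_less_1 by (simp add: Vb_snoc_Inr)
  also have "\<dots> = rho m * Va g + (\<Sum>i\<in>{1..<int k} - {m}. rho (i - m) * B (g @ [Inr i])) - d * (1 - r)"
    using s by (simp add: right_diff_distrib sum_subtractf flip: sum_distrib_right) (simp add: algebra_simps)
  finally show ?thesis
    unfolding w potential_def Va jm e[of "\<lambda>i. rho (i - m) * B (g @ [Inr i])"] by simp
qed

text \<open>Right multiplication by \<open>a\<close> exchanges the two conditional means: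
  \<open>a\<close> cancels against a first letter \<open>a\<close> of \<xi>, and is absorbed as a
  new first letter when \<xi> begins with a power of \<open>b\<close>. The term with
  \<open>d\<close> accounts for the change in the number of consumed letters.\<close>

lemma potential_mult_a:
  assumes w: "w \<in> words k"
  shows "potential (word_mult k w [Inl 1]) = r * Vb w + (1 - r) * Va w + d * (1 - 2 * r)"
proof (cases "w = [] \<or> \<not> isl (last w)")
  case True
  note wa = word_mult_a[OF k w True]
  have "Vb (w @ [Inl 1]) = B (w @ [Inl 1])"
    using Vb_open[of "w @ [Inl 1]"] B_b[OF wa(1)] by simp
  also have "\<dots> = Va w + d" using Va_open[OF True] by simp
  finally show ?thesis unfolding wa potential_def Va_snoc_Inl by (simp add: algebra_simps)
next
  case False
  then obtain g where g: "w = g @ [Inl 1]" "g \<in> words k" "g = [] \<or> \<not> isl (last g)" "word_mult k w [Inl 1] = g"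
    using words_ends_a[OF k w] by auto
  have "Vb w = B w" using Vb_open[of w] B_b[OF w] False by simp
  then have "Va g + d = Vb w" using Va_open[OF g(3)] g(1) by simp
  moreover have "Vb g = Va w + d" using Va_snoc_Inl g(1) by simp
  ultimately show ?thesis unfolding g(4) potential_def by (simp add: algebra_simps flip: \<open>Va g + d = Vb w\<close>)
qed

text \<open>For \<open>d = 0\<close> this is harmonicity under the walk; for \<open>d = 1\<close> it
  gives the constant mean increment \<open>(1 - 2 * y) / 3\<close>.\<close>

theorem potential_step:
  assumes w: "w \<in> words k"
  shows "potential (word_mult k w [Inl 1]) + potential (word_mult k w [Inr 1])
      + potential (word_mult k w [Inr (int k - 1)]) = 3 * potential w + d * (1 - 2 * y)"
proof -
  obtain g j where g: "g \<in> b_open k" and wj: "w = b_power k g j" using words_cases[OF k w] .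
  let ?B = "\<lambda>i. B (g @ [Inr i])" and ?I = "{1..<int k}"
  have b: "potential (word_mult k w [Inr 1]) =
      rho (j + 1) * Va g + (\<Sum>i\<in>?I. rho (i - j - 1) * ?B i) - d * (1 - r)"
    unfolding wj using k by (subst word_mult_b_power[OF k g]) (auto simp: potential_b_power[OF g] algebra_simps)
  have "rho (j + (int k - 1)) = rho (j - 1)" "rho (i - (j + (int k - 1))) = rho (i - j + 1)" for i
    using rho_period[of "j - 1"] rho_period[of "i - (j + (int k - 1))"] by (simp_all add: algebra_simps)
  then have b': "potential (word_mult k w [Inr (int k - 1)]) =
      rho (j - 1) * Va g + (\<Sum>i\<in>?I. rho (i - j + 1) * ?B i) - d * (1 - r)"
    unfolding wj using k by (subst word_mult_b_power[OF k g]) (auto simp: potential_b_power[OF g])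
  have bb: "potential (word_mult k w [Inr 1]) + potential (word_mult k w [Inr (int k - 1)])
     = (rho (j + 1) + rho (j - 1)) * Va g
       + (\<Sum>i\<in>?I. (rho (i - j + 1) + rho (i - j - 1)) * ?B i) - 2 * d * (1 - r)"
    unfolding b b' by (simp add: sum.distrib distrib_right)
  note a = potential_mult_a[OF w]
  \<comment> \<open>Off the multiples of \<open>k\<close>, \<open>rho_rec\<close> applies; at a
    multiple both neighbours have weight \<open>y\<close>. In the first case the exceptional
    argument is \<open>j\<close>, in the coefficient of \<open>Va g\<close>; in the second it is
    \<open>i - j\<close> for \<open>i = m\<close>, and produces the extra multiple of
    \<open>B w = Va w\<close>.\<close>
  show ?thesis
  proof (cases "j mod int k = 0")
    case True
    then have [simp]: "w = g" by (simp add: wj b_power_def)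
    have "(\<Sum>i\<in>?I. (rho (i - j + 1) + rho (i - j - 1)) * ?B i) = (\<Sum>i\<in>?I. cc * (rho i * ?B i))"
    proof (intro sum.cong refl)
      fix i assume i: "i \<in> ?I"
      have "(i - j) mod int k = i mod int k" using True by (metis diff_0_right mod_diff_right_eq)
      then have "(i - j) mod int k \<noteq> 0" "rho (i - j) = rho i" using i by (auto intro: rho_cong)
      then show "(rho (i - j + 1) + rho (i - j - 1)) * ?B i = cc * (rho i * ?B i)"
        using rho_rec[of "i - j"] by simp
    qed
    also have "\<dots> = cc * ((1 - r) * (Vb g + d))"
      unfolding b_open_Vb[OF g] by (simp add: sum_distrib_left)
    also have "\<dots> = (3 - 4 * r) * (Vb g + d)" by (simp add: cc_eq flip: mult.assoc)
    finally have "potential (word_mult k w [Inr 1]) + potential (word_mult k w [Inr (int k - 1)])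
       = 2 * y * Va g + (3 - 4 * r) * (Vb g + d) - 2 * d * (1 - r)"
      unfolding bb using rho_rec_0[OF True] by simp
    then show ?thesis using a r_less_1(3) unfolding potential_def[of w] by simp algebra
  next
    case False
    define m where "m = j mod int k"
    have m: "m \<in> ?I" using mod_range[of j] False by (auto simp: m_def)
    have wm: "w = g @ [Inr m]" using False by (simp add: wj b_power_def m_def)
    have Va: "Va w = B w" using Va_open[of w] B_a[of w] w wm by simp
    have "(rho (i - j + 1) + rho (i - j - 1)) * ?B i = cc * (rho (i - j) * ?B i) + (if i = m then (2 * y - cc * r) * B w else 0)"
      if i: "i \<in> ?I" for i
    proof (cases "i = m")
      case True
      then have z: "(i - j) mod int k = 0" by (simp add: m_def mod_diff_left_eq)
      then have "rho (i - j) = r" by (intro rho_cong) simp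
      then show ?thesis using True rho_rec_0[OF z] wm by (simp add: algebra_simps)
    next
      case False
      have "(i - j) mod int k \<noteq> 0"
      proof
        assume "(i - j) mod int k = 0"
        then have "i mod int k = j mod int k" by (simp add: mod_eq_dvd_iff mod_0_imp_dvd)
        then show False using i False by (simp add: m_def)
      qed
      then show ?thesis using False rho_rec[of "i - j"] by simp
    qed
    then have "(\<Sum>i\<in>?I. (rho (i - j + 1) + rho (i - j - 1)) * ?B i)
        = cc * (\<Sum>i\<in>?I. rho (i - j) * ?B i) + (2 * y - cc * r) * B w"
      using m by (simp add: sum.distrib sum_distrib_left)
    then have "potential (word_mult k w [Inr 1]) + potential (word_mult k w [Inr (int k - 1)])
       = cc * (potential w + d * (1 - r)) + (2 * y - cc * r) * Va w - 2 * d * (1 - r)"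
      unfolding bb rho_rec[OF False] Va using potential_b_power[OF g, of j] wj
      by (simp add: algebra_simps)
    \<comment> \<open>Multiplying by \<open>1 - r\<close> lets \<open>cc\<close> be eliminated
      through the polynomial relation \<open>cc_eq\<close>.\<close>
    then have "(potential (word_mult k w [Inr 1]) + potential (word_mult k w [Inr (int k - 1)])
        - (cc * (potential w + d * (1 - r)) + (2 * y - cc * r) * Va w - 2 * d * (1 - r))) * (1 - r) = 0"
      by simp
    moreover note cc_eq
    moreover have "(1 - r) * Vb w = potential w - r * Va w" by (simp add: potential_def)
    ultimately have "(potential (word_mult k w [Inl 1]) + potential (word_mult k w [Inr 1])
      + potential (word_mult k w [Inr (int k - 1)]) - (3 * potential w + d * (1 - 2 * y))) * (1 - r) = 0"
      using a r_less_1(3) by algebra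
    then show ?thesis using r_less_1 by simp
  qed
qed

end
end
end

section \<open>The length and the cylinder potentials\<close>

text \<open>By alternation at least half of the letters are powers of \<open>b\<close>, up to a
  leading \<open>a\<close>. This converts a contraction per power of \<open>b\<close> into a decay
  in the length.\<close>

lemma length_le_count_Inr:
  assumes "successively (\<lambda>u v. isl u \<noteq> isl v) v"
  shows "length v \<le> 2 * length (filter (\<lambda>u. \<not> isl u) v) + (if v \<noteq> [] \<and> isl (hd v) then 1 else 0)"
  using assms by (induction v) (auto simp: successively_Cons split: if_splits)

context letter_weights
begin

text \<open>The largest probability of a single power of \<open>b\<close>, given that \<xi> begins
  with a power of \<open>b\<close>. It bounds the chance that a final power of \<open>b\<close>
  cancels completely.\<close>

definition theta :: real where "theta = Max (rho ` {1..<int k}) / (1 - r)"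

lemma rho_le_theta: "j \<in> {1..<int k} \<Longrightarrow> rho j \<le> theta * (1 - r)"
  using r_less_1 by (simp add: theta_def)

lemma theta: "0 < theta" "theta < 1"
proof -
  have ne: "rho ` {1..<int k} \<noteq> {}" using k by auto
  obtain j where j: "j \<in> {1..<int k}" "Max (rho ` {1..<int k}) = rho j"
    using Max_in[OF _ ne] by auto
  \<comment> \<open>Since \<open>k \<ge> 3\<close>, a second exponent exists, and its positive
    weight keeps \<open>theta\<close> below 1.\<close>
  obtain i where i: "i \<in> {1..<int k}" "i \<noteq> j"
    using k that[of 1] that[of 2] by (cases "j = 1") auto
  have "rho j + rho i = sum rho {i, j}" using i by simp
  also have "\<dots> \<le> sum rho {1..<int k}"
    using i j rho_pos by (intro sum_mono2) (auto intro: less_imp_le)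
  finally have "rho j < 1 - r" using rho_pos[of i] sum_rho by simp
  then show "0 < theta" "theta < 1" using j rho_pos[of j] r_less_1 by (simp_all add: theta_def)
qed

lemma sum_rho_remove:
  assumes "j \<in> {1..<int k}"
  shows "(\<Sum>i\<in>{1..<int k} - {j}. rho (i - j)) = 1 - r - rho j"
  using sum_rho_shift[of j] sum.remove[of "{1..<int k}" j "\<lambda>i. rho (i - j)"] assms by simp

text \<open>If \<open>B\<close> takes the same value on all \<open>g @ [Inr i]\<close>, only full
  cancellation of the last letter can move the mean away from \<open>c - d\<close>, and it has
  weight \<open>rho j\<close>.\<close>

lemma Vb_snoc_Inr_const:
  assumes "j \<in> {1..<int k}" "\<And>i. i \<in> {1..<int k} \<Longrightarrow> B (g @ [Inr i]) = c"
  shows "(1 - r) * (Vb B d (g @ [Inr j]) - (c - d)) = rho j * (Va B d g - c)"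
proof -
  have "(1 - r) * Vb B d (g @ [Inr j]) = rho j * (Va B d g - d) + (\<Sum>i\<in>{1..<int k} - {j}. rho (i - j) * (c - d))"
    using assms r_less_1 by (simp add: Vb_snoc_Inr)
  also have "(\<Sum>i\<in>{1..<int k} - {j}. rho (i - j) * (c - d)) = (1 - r - rho j) * (c - d)"
    using sum_rho_remove[OF assms(1)] by (simp flip: sum_distrib_right)
  finally show ?thesis by (simp add: algebra_simps)
qed

lemma abs_Vb_snoc_Inr_const_le:
  assumes j: "j \<in> {1..<int k}" and B: "\<And>i. i \<in> {1..<int k} \<Longrightarrow> B (g @ [Inr i]) = c"
  shows "\<bar>Vb B d (g @ [Inr j]) - (c - d)\<bar> \<le> theta * \<bar>Va B d g - c\<bar>"
proof -
  have "(1 - r) * \<bar>Vb B d (g @ [Inr j]) - (c - d)\<bar> = rho j * \<bar>Va B d g - c\<bar>"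
    using arg_cong[OF Vb_snoc_Inr_const[of j B g c d], of abs] j B rho_pos[of j] r_less_1 by (simp add: abs_mult)
  also have "\<dots> \<le> theta * (1 - r) * \<bar>Va B d g - c\<bar>"
    by (intro mult_right_mono rho_le_theta assms) auto
  finally show ?thesis using r_less_1 by (simp add: mult.commute mult.left_commute)
qed

lemma sum_weights: "(\<Sum>i\<in>{1..<int k}. rho i / (1 - r)) = 1"
  using sum_rho r_less_1 by (simp flip: sum_divide_distrib)

lemma sum_weights_const: "(\<Sum>i\<in>{1..<int k}. rho i / (1 - r) * c) = c"
  using sum_weights by (simp only: flip: sum_distrib_right)

lemma b_open_extend: "g \<in> b_open k \<Longrightarrow> i \<in> {1..<int k} \<Longrightarrow> g @ [Inr i] \<in> words k"
  using k by (auto simp: b_open_def words_snoc letters_Z2_Zk)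

lemma words_snocE:
  assumes "g @ [u] \<in> words k"
  obtains "u = Inl 1" "g \<in> words k" "g = [] \<or> \<not> isl (last g)"
  | j where "u = Inr j" "j \<in> {1..<int k}" "g \<in> b_open k" "g \<in> words k"
  using assms k by (auto simp: words_snoc b_open_def letters_Z2_Zk)

abbreviation len :: "(int + int) list \<Rightarrow> real" where "len g \<equiv> real (length g)"

abbreviation length_potential :: "(int + int) list \<Rightarrow> real" where
  "length_potential \<equiv> potential len 1"

lemma length_potential_step:
  assumes "w \<in> words k"
  shows "length_potential (word_mult k w [Inl 1]) + length_potential (word_mult k w [Inr 1])
      + length_potential (word_mult k w [Inr (int k - 1)]) = 3 * length_potential w + (1 - 2 * y)"
proof -
  have "len g = (\<Sum>i\<in>{1..<int k}. rho i / (1 - r) * len (g @ [Inr i])) - 1" for g :: "(int + int) list"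
    using sum_weights_const[of "len g + 1"] by (simp add: add.commute)
  then show ?thesis using potential_step[of len 1, OF _ _ assms] by simp
qed

text \<open>After a final \<open>a\<close> the value of \<open>Vb\<close> is the exact length, after
  a final power of \<open>b\<close> that of \<open>Va\<close> is. The remaining mean inherits the
  error of the shorter word, contracted by \<open>theta\<close> whenever a power of \<open>b\<close>
  is passed, so the errors stay bounded.\<close>

lemma length_potential_bounded:
  obtains C where "\<And>w. w \<in> words k \<Longrightarrow> \<bar>length_potential w - len w\<bar> \<le> C"
proof -
  \<comment> \<open>Passing a power of \<open>b\<close> turns the bound \<open>K + 2\<close> on the
    error of \<open>Va\<close> into \<open>theta * (K + 3) + 1\<close> for \<open>Vb\<close>; this
    \<open>K\<close> makes it at most \<open>K\<close>.\<close>
  define K where "K = 4 / (1 - theta)"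
  have "K * (1 - theta) = 4" using theta unfolding K_def by (metis diff_gt_0_iff_gt less_irrefl nonzero_eq_divide_eq)
  then have "theta * (K + 3) + 1 \<le> K" using theta by (simp add: algebra_simps)
  moreover have "0 \<le> K" using theta by (simp add: K_def)
  ultimately have K: "theta * (K + 3) + 1 \<le> K" "0 \<le> K" by blast+
  have "\<bar>Va len 1 w - len w\<bar> \<le> K + 2 \<and> \<bar>Vb len 1 w - len w\<bar> \<le> K" if "w \<in> words k" for w
    using that
  proof (induction w rule: rev_induct)
    case Nil
    then show ?case using K sum_weights by (simp add: Va_open Vb_open)
  next
    case (snoc u g)
    from snoc.prems show ?case
    proof (cases rule: words_snocE)
      case 1
      have "Vb len 1 (g @ [u]) = len (g @ [u])"
        using 1 sum_weights_const[of "len g + 2"] by (simp add: Vb_open add.commute)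
      then show ?thesis using snoc.IH 1 K by (auto simp: Va_snoc_Inl)
    next
      case (2 j)
      have "\<bar>Vb len 1 (g @ [u]) - (len g + 1 - 1)\<bar> \<le> theta * \<bar>Va len 1 g - (len g + 1)\<bar>"
        unfolding 2 by (rule abs_Vb_snoc_Inr_const_le) (use 2 in auto)
      also have "\<dots> \<le> theta * (K + 3)" using snoc.IH 2 theta by (intro mult_left_mono) auto
      finally show ?thesis using K 2 by (auto simp: Va_open)
    qed
  qed
  then have V: "\<bar>Va len 1 w - len w\<bar> \<le> K + 2" "\<bar>Vb len 1 w - len w\<bar> \<le> K + 2" if "w \<in> words k" for w
    using that by fastforce+
  have "\<bar>length_potential w - len w\<bar> \<le> K + 2" if "w \<in> words k" for w
  proof -
    have "length_potential w - len w = r * (Va len 1 w - len w) + (1 - r) * (Vb len 1 w - len w)"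
      by (simp add: potential_def algebra_simps)
    also have "\<bar>\<dots>\<bar> \<le> r * \<bar>Va len 1 w - len w\<bar> + (1 - r) * \<bar>Vb len 1 w - len w\<bar>"
      using r_less_1 by (intro order_trans[OF abs_triangle_ineq]) (simp add: abs_mult)
    also have "\<dots> \<le> r * (K + 2) + (1 - r) * (K + 2)"
      using r_less_1 V[OF that] by (intro add_mono mult_left_mono) auto
    finally show ?thesis by (simp add: algebra_simps)
  qed
  then show ?thesis by (rule that)
qed

section \<open>Cylinder probabilities as bounded harmonic functions\<close>

definition letter_weight :: "int + int \<Rightarrow> real" where
  "letter_weight u = (case u of Inl _ \<Rightarrow> 1 | Inr i \<Rightarrow> rho i / (1 - r))"

text \<open>The probability that \<open>g \<xi>\<close> starts with \<open>w\<close>, given that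
  \<xi> begins with a letter of the factor not containing the last letter of \<open>g\<close>; then
  nothing cancels or merges.\<close>

definition cylinder_value :: "(int + int) list \<Rightarrow> (int + int) list \<Rightarrow> real" where
  "cylinder_value w g =
     (if prefix w g then 1
      else if prefix g w then prod_list (map letter_weight (drop (length g) w)) else 0)"

lemma cylinder_value_prefix: "prefix w g \<Longrightarrow> cylinder_value w g = 1"
  by (simp add: cylinder_value_def)

lemma cylinder_value_append: "cylinder_value (g @ z) g = prod_list (map letter_weight z)"
  by (auto simp: cylinder_value_def prefix_def)

lemma cylinder_value_snoc_other: "u \<noteq> v \<Longrightarrow> cylinder_value (g @ u # z) (g @ [v]) = 0"
  by (auto simp: cylinder_value_def prefix_def append_eq_append_conv2 Cons_eq_append_conv)

lemma cylinder_value_incomparable: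
  "\<not> prefix w g \<Longrightarrow> \<not> prefix g w \<Longrightarrow> cylinder_value w (g @ z) = 0"
  by (auto simp: cylinder_value_def prefix_append) (metis append_prefixD prefixI prefix_same_cases)+

text \<open>If \<open>w\<close> properly extends \<open>g\<close>, alternation forces its next
  letter to be \<open>a\<close>, which has weight 1. Together with \<open>cylinder_value_b\<close>
  this verifies the hypotheses on \<open>B\<close> for \<open>d = 0\<close>.\<close>

lemma cylinder_value_a:
  assumes "w \<in> words k" "g \<noteq> []" "\<not> isl (last g)"
  shows "cylinder_value w g = cylinder_value w (g @ [Inl 1])"
proof -
  consider "prefix w g" | u z where "w = g @ u # z" | "\<not> prefix w g" "\<not> prefix g w"
    by (metis neq_Nil_conv append_Nil2 prefix_def prefix_order.refl)
  then show ?thesis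
  proof cases
    case (2 u z)
    have "successively (\<lambda>u v. isl u \<noteq> isl v) (g @ u # z)" "u \<in> letters (integer_mod_group 2) (integer_mod_group k)"
      using assms(1) 2 by (auto simp: normal_words_def)
    then have "u = Inl 1" using assms k by (auto simp: successively_append_iff letters_Z2_Zk)
    then show ?thesis
      using cylinder_value_append[of g "u # z"] cylinder_value_append[of "g @ [u]" z]
      by (simp add: 2 letter_weight_def)
  next
    case 3
    then show ?thesis using cylinder_value_incomparable[of w g "[]"] by (simp add: cylinder_value_incomparable)
  qed (simp add: cylinder_value_prefix)
qed

lemma sum_cylinder_value:
  assumes "j \<in> {1..<int k}"
  shows "(\<Sum>i\<in>{1..<int k}. rho i * cylinder_value (g @ Inr j # z) (g @ [Inr i]))
     = rho j * prod_list (map letter_weight z)"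
proof -
  have "(\<Sum>i\<in>{1..<int k}. rho i * cylinder_value (g @ Inr j # z) (g @ [Inr i]))
     = (\<Sum>i\<in>{1..<int k}. if i = j then rho j * prod_list (map letter_weight z) else 0)"
    using cylinder_value_append[of "g @ [Inr j]" z]
    by (intro sum.cong) (auto simp: cylinder_value_snoc_other)
  then show ?thesis using assms by simp
qed

lemma cylinder_value_b:
  assumes "w \<in> words k" "g \<noteq> []" "isl (last g)"
  shows "cylinder_value w g = (\<Sum>i\<in>{1..<int k}. rho i / (1 - r) * cylinder_value w (g @ [Inr i]))"
proof -
  consider "prefix w g" | u z where "w = g @ u # z" | "\<not> prefix w g" "\<not> prefix g w"
    by (metis neq_Nil_conv append_Nil2 prefix_def prefix_order.refl)
  then show ?thesis
  proof cases
    case 1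
    then show ?thesis using sum_weights by (simp add: cylinder_value_prefix)
  next
    case (2 u z)
    have "successively (\<lambda>u v. isl u \<noteq> isl v) (g @ u # z)" "u \<in> letters (integer_mod_group 2) (integer_mod_group k)"
      using assms(1) 2 by (auto simp: normal_words_def)
    then obtain j where j: "u = Inr j" "j \<in> {1..<int k}"
      using assms k by (auto simp: successively_append_iff letters_Z2_Zk)
    then show ?thesis
      using cylinder_value_append[of g "u # z"] sum_cylinder_value[OF j(2), of g z]
      by (simp add: 2 letter_weight_def flip: sum_divide_distrib)
  next
    case 3
    then show ?thesis using cylinder_value_incomparable[of w g "[]"] by (simp add: cylinder_value_incomparable)
  qed
qed

lemma cylinder_value_nonneg: "w \<in> words k \<Longrightarrow> 0 \<le> cylinder_value w g"
  and cylinder_value_le_1: "w \<in> words k \<Longrightarrow> cylinder_value w g \<le> 1"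
proof -
  assume w: "w \<in> words k"
  have lw: "0 \<le> letter_weight u \<and> letter_weight u \<le> 1" if "u \<in> set w" for u
  proof -
    have "u \<in> letters (integer_mod_group 2) (integer_mod_group k)" using w that by (auto simp: normal_words_def)
    then show ?thesis using k
    proof (auto simp: letters_Z2_Zk letter_weight_def)
      fix j assume "1 \<le> j" "j < int k"
      then have j: "j \<in> {1..<int k}" by simp
      show "0 \<le> rho j / (1 - r)" using r_less_1 rho_pos[of j] by simp
      have "rho j \<le> 1 - r" using rho_le_theta[OF j] theta r_less_1 by (smt (verit) mult_le_cancel_right2)
      then show "rho j / (1 - r) \<le> 1" using r_less_1 by simp
    qed
  qed
  have "0 \<le> prod_list (map letter_weight z) \<and> prod_list (map letter_weight z) \<le> 1" if "set z \<subseteq> set w" for z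
    using that lw by (induction z) (auto simp: mult_le_one)
  then show "0 \<le> cylinder_value w g" "cylinder_value w g \<le> 1"
    by (auto simp: cylinder_value_def set_drop_subset)
qed

abbreviation cylinder_potential :: "(int + int) list \<Rightarrow> (int + int) list \<Rightarrow> real" where
  "cylinder_potential w \<equiv> potential (cylinder_value w) 0"

lemma cylinder_potential_step:
  assumes "w \<in> words k" "g \<in> words k"
  shows "cylinder_potential w (word_mult k g [Inl 1]) + cylinder_potential w (word_mult k g [Inr 1])
      + cylinder_potential w (word_mult k g [Inr (int k - 1)]) = 3 * cylinder_potential w g"
  using potential_step[of "cylinder_value w" 0, OF _ _ assms(2)]
    cylinder_value_a[OF assms(1)] cylinder_value_b[OF assms(1)] by simp

text \<open>Each step of the recursion either copies an earlier value or averages values in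
  \<open>[0, 1]\<close> with nonnegative weights of total 1.\<close>

lemma conditional_cylinder_bounds:
  assumes w: "w \<in> words k" and "g \<in> words k"
  shows "Va (cylinder_value w) 0 g \<in> {0..1} \<and> Vb (cylinder_value w) 0 g \<in> {0..1}"
  using assms(2)
proof (induction g rule: rev_induct)
  note B = cylinder_value_nonneg[OF w] cylinder_value_le_1[OF w]
  have open_b: "Vb (cylinder_value w) 0 g \<in> {0..1}" if "g = [] \<or> isl (last g)" for g
  proof -
    have "0 \<le> (\<Sum>i\<in>{1..<int k}. rho i / (1 - r) * cylinder_value w (g @ [Inr i]))"
      using B r_less_1 by (intro sum_nonneg mult_nonneg_nonneg divide_nonneg_pos) (auto intro: less_imp_le[OF rho_pos])
    moreover have "(\<Sum>i\<in>{1..<int k}. rho i / (1 - r) * cylinder_value w (g @ [Inr i])) \<le> (\<Sum>i\<in>{1..<int k}. rho i / (1 - r) * 1)"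
      using B r_less_1 by (intro sum_mono mult_left_mono divide_nonneg_pos) (auto intro: less_imp_le[OF rho_pos])
    ultimately show ?thesis using sum_weights by (simp add: Vb_open[OF that])
  qed
  {
    case Nil
    show ?case using B open_b[of "[]"] by (auto simp: Va_open)
  next
    case (snoc u g)
    from snoc.prems show ?case
    proof (cases rule: words_snocE)
      case 1
      then show ?thesis using snoc.IH open_b[of "g @ [u]"] by (auto simp: Va_snoc_Inl)
    next
      case (2 j)
      let ?V = "Va (cylinder_value w) 0 g" and ?J = "{1..<int k} - {j}"
      let ?S = "rho j * ?V + (\<Sum>i\<in>?J. rho (i - j) * cylinder_value w (g @ [Inr i]))"
      have V: "0 \<le> ?V" "?V \<le> 1" using snoc.IH 2 by auto
      have "0 \<le> ?S"
        using B V by (intro add_nonneg_nonneg sum_nonneg mult_nonneg_nonneg) (auto intro: less_imp_le[OF rho_pos])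
      moreover have "?S \<le> rho j * 1 + (\<Sum>i\<in>?J. rho (i - j) * 1)"
        using B V by (intro add_mono sum_mono mult_left_mono) (auto intro: less_imp_le[OF rho_pos])
      ultimately have "Vb (cylinder_value w) 0 (g @ [u]) \<in> {0..1}"
        using 2 sum_rho_remove[of j] r_less_1 by (simp add: Vb_snoc_Inr)
      then show ?thesis using 2 B by (auto simp: Va_open)
    qed
  }
qed

lemma convex_comb_01: "x \<in> {0..1} \<Longrightarrow> z \<in> {0..1} \<Longrightarrow> r * x + (1 - r) * z \<in> {0..1}"
  using convexD[of "{0..1::real}" x z r "1 - r"] r_less_1 by simp

lemma cylinder_potential_bounds:
  "w \<in> words k \<Longrightarrow> g \<in> words k \<Longrightarrow> cylinder_potential w g \<in> {0..1}"
  unfolding potential_def using conditional_cylinder_bounds by (intro convex_comb_01) auto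

text \<open>Among the words starting with \<open>p\<close> the boundary value is the constant
  \<open>c\<close>. Hence each power of \<open>b\<close> in \<open>v\<close> contracts the distance
  to \<open>c\<close> by \<open>theta\<close>, and a letter \<open>a\<close> does not increase
  it.\<close>

lemma conditional_cone:
  assumes w: "w \<in> words k"
    and const: "\<And>v. p @ v \<in> words k \<Longrightarrow> cylinder_value w (p @ v) = c" and c: "c \<in> {0..1}"
    and "p @ v \<in> words k"
  shows "\<bar>Va (cylinder_value w) 0 (p @ v) - c\<bar> \<le> theta ^ length (filter (\<lambda>u. \<not> isl u) v) \<and>
         \<bar>Vb (cylinder_value w) 0 (p @ v) - c\<bar> \<le> theta ^ length (filter (\<lambda>u. \<not> isl u) v)"
  using assms(4)
proof (induction v rule: rev_induct)
  case Nil
  then show ?case using conditional_cylinder_bounds[OF w Nil] c by auto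
next
  case (snoc u v)
  let ?n = "length (filter (\<lambda>u. \<not> isl u) v)"
  have "(p @ v) @ [u] \<in> words k" using snoc.prems by simp
  then show ?case
  proof (cases rule: words_snocE)
    case 1
    have "Vb (cylinder_value w) 0 ((p @ v) @ [u]) = c"
      using Vb_open[of "(p @ v) @ [u]"] cylinder_value_b[OF w, of "(p @ v) @ [u]"] 1 const[of "v @ [u]"] snoc.prems
      by simp
    moreover have "Va (cylinder_value w) 0 ((p @ v) @ [u]) = Vb (cylinder_value w) 0 (p @ v)"
      unfolding 1 by (simp only: Va_snoc_Inl diff_0_right)
    ultimately show ?thesis using snoc.IH 1 theta by simp
  next
    case (2 j)
    have "Va (cylinder_value w) 0 ((p @ v) @ [u]) = c"
      using Va_open[of "(p @ v) @ [u]"] cylinder_value_a[OF w, of "(p @ v) @ [u]"] 2 const[of "v @ [u]"] snoc.prems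
      by simp
    have "\<bar>Vb (cylinder_value w) 0 ((p @ v) @ [Inr j]) - (c - 0)\<bar> \<le> theta * \<bar>Va (cylinder_value w) 0 (p @ v) - c\<bar>"
      using 2 const b_open_extend[of "p @ v"] by (intro abs_Vb_snoc_Inr_const_le) auto
    also have "\<dots> \<le> theta * theta ^ ?n"
      using snoc.IH 2 theta by (intro mult_left_mono) auto
    finally show ?thesis using 2 theta \<open>Va _ _ _ = c\<close> by simp
  qed
qed

lemma cylinder_potential_approx:
  assumes w: "w \<in> words k" and g: "g \<in> words k" and len: "length w \<le> length g"
  shows "\<bar>cylinder_potential w g - (if prefix w g then 1 else 0)\<bar> \<le> theta ^ ((length g - length w) div 2)"
proof -
  \<comment> \<open>Cutting \<open>g\<close> at the length of \<open>w\<close> decides the cylinder: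
    either all extensions of \<open>p\<close> start with \<open>w\<close> or none does.\<close>
  define p where "p = take (length w) g"
  define v where "v = drop (length w) g"
  define c :: real where "c = (if prefix w g then 1 else 0)"
  let ?n = "length (filter (\<lambda>u. \<not> isl u) v)"
  have pv: "g = p @ v" "length p = length w" "length v = length g - length w"
    using len by (auto simp: p_def v_def)
  have pre: "prefix w g \<longleftrightarrow> p = w" using pv by (auto simp: prefix_def)
  have const: "cylinder_value w (p @ z) = c" for z
  proof (cases "p = w")
    case False
    then have "\<not> prefix w p" "\<not> prefix p w" using pv(2) by (auto simp: prefix_def)
    then show ?thesis using False pre by (simp add: c_def cylinder_value_incomparable)
  qed (simp add: c_def pre cylinder_value_prefix)
  have V: "\<bar>Va (cylinder_value w) 0 g - c\<bar> \<le> theta ^ ?n" "\<bar>Vb (cylinder_value w) 0 g - c\<bar> \<le> theta ^ ?n"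
    using conditional_cone[OF w, of p c v] const g pv by (auto simp: c_def)
  have "cylinder_potential w g - c = r * (Va (cylinder_value w) 0 g - c) + (1 - r) * (Vb (cylinder_value w) 0 g - c)"
    by (simp add: potential_def algebra_simps)
  also have "\<bar>\<dots>\<bar> \<le> r * \<bar>Va (cylinder_value w) 0 g - c\<bar> + (1 - r) * \<bar>Vb (cylinder_value w) 0 g - c\<bar>"
    using r_less_1 by (intro order_trans[OF abs_triangle_ineq]) (simp add: abs_mult)
  also have "\<dots> \<le> r * theta ^ ?n + (1 - r) * theta ^ ?n"
    using r_less_1 V by (intro add_mono mult_left_mono) auto
  also have "\<dots> = theta ^ ?n" by (simp add: algebra_simps)
  also have "\<dots> \<le> theta ^ ((length g - length w) div 2)"
  proof (rule power_decreasing)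
    have "successively (\<lambda>u v. isl u \<noteq> isl v) v"
      using g pv(1) by (auto simp: normal_words_def successively_append_iff)
    then show "(length g - length w) div 2 \<le> ?n"
      using length_le_count_Inr[of v] pv(3) by (auto split: if_splits)
  qed (use theta in auto)
  finally show ?thesis by (simp add: c_def)
qed

text \<open>At the identity nothing interacts with \<xi>, so this is the mass of the cylinder: an
  unconditional weight for the first letter, conditional weights for the later ones.\<close>

lemma cylinder_potential_Nil:
  assumes "u # z \<in> words k"
  shows "cylinder_potential (u # z) [] =
    (case u of Inl _ \<Rightarrow> r | Inr i \<Rightarrow> rho i) * prod_list (map letter_weight z)"
proof -
  have "cylinder_potential (u # z) [] =
      r * cylinder_value (u # z) [Inl 1] + (\<Sum>i\<in>{1..<int k}. rho i * cylinder_value (u # z) [Inr i])"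
    using b_open_Vb[of "[]" "cylinder_value (u # z)" 0] by (simp add: potential_def Va_open b_open_def)
  moreover have "u \<in> letters (integer_mod_group 2) (integer_mod_group k)"
    using assms by (simp add: normal_words_Cons)
  then consider "u = Inl 1" | j where "u = Inr j" "j \<in> {1..<int k}" using k by (auto simp: letters_Z2_Zk)
  then have "r * cylinder_value (u # z) [Inl 1] + (\<Sum>i\<in>{1..<int k}. rho i * cylinder_value (u # z) [Inr i])
     = (case u of Inl _ \<Rightarrow> r | Inr i \<Rightarrow> rho i) * prod_list (map letter_weight z)"
  proof cases
    case 1
    then show ?thesis
      using cylinder_value_append[of "[u]" z] cylinder_value_snoc_other[of u _ "[]" z] by simp
  next
    case (2 j)
    then show ?thesis
      using sum_cylinder_value[of j "[]" z] cylinder_value_snoc_other[of u _ "[]" z] by simp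
  qed
  ultimately show ?thesis by simp
qed

text \<open>The two products differ only in bookkeeping: the Markovian formula divides the weight of
  a letter by the total weight of the other factor, whereas \<open>letter_weight\<close> attaches
  that denominator to the next letter, which lies in that factor.\<close>

lemma markov_mass_eq:
  fixes R :: "int + int \<Rightarrow> real"
  assumes R: "R (Inl 1) = r" "\<And>i. i \<in> {1..<int k} \<Longrightarrow> R (Inr i) = rho i"
    and "u # z \<in> words k"
  shows "(\<Prod>i < length (u # z) - 1. R ((u # z) ! i) /
            (\<Sum>v \<in> {v \<in> letters (integer_mod_group 2) (integer_mod_group k). isl v \<noteq> isl ((u # z) ! i)}. R v))
          * R (last (u # z)) = cylinder_potential (u # z) []"
  using assms(3)
proof (induction z arbitrary: u)
  case Nil
  then show ?case using R k by (auto simp: cylinder_potential_Nil normal_words_Cons letters_Z2_Zk)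
next
  case (Cons v z)
  let ?D = "\<lambda>u. \<Sum>v \<in> {v \<in> letters (integer_mod_group 2) (integer_mod_group k). isl v \<noteq> isl u}. R v"
  have vz: "v # z \<in> words k" and uv: "isl u \<noteq> isl v"
    and u: "u \<in> letters (integer_mod_group 2) (integer_mod_group k)"
    and v: "v \<in> letters (integer_mod_group 2) (integer_mod_group k)"
    using Cons.prems by (auto simp: normal_words_Cons)
  let ?rho = "\<lambda>u. case u of Inl _ \<Rightarrow> r | Inr i \<Rightarrow> rho i"
  have "{v \<in> letters (integer_mod_group 2) (integer_mod_group k). isl v} = {Inl 1}"
    "{v \<in> letters (integer_mod_group 2) (integer_mod_group k). \<not> isl v} = Inr ` {1..<int k}"
    using k by (auto simp: letters_Z2_Zk)
  then have D: "?D u = (if isl u then 1 - r else r)"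
    using R sum_rho by (simp add: sum.reindex)
  have "R u / ?D u * ?rho v = ?rho u * letter_weight v"
    unfolding D using u v uv k R r_less_1 by (auto simp: letters_Z2_Zk letter_weight_def)
  then have "R u / ?D u * cylinder_potential (v # z) [] = cylinder_potential (u # v # z) []"
    by (simp add: cylinder_potential_Nil[OF vz] cylinder_potential_Nil[OF Cons.prems] mult.assoc[symmetric])
  then show ?case unfolding Cons.IH[OF vz, symmetric]
    by (simp add: prod.lessThan_Suc_shift del: prod.lessThan_Suc)
qed

end

section \<open>The law of a random walk\<close>

lemma right_walk_measurable:
  fixes x :: "nat \<Rightarrow> 'w \<Rightarrow> 'g :: countable"
  assumes "\<And>m. m < n \<Longrightarrow> x m \<in> M \<rightarrow>\<^sub>M count_space UNIV"
  shows "right_walk \<Gamma> x n \<in> M \<rightarrow>\<^sub>M count_space UNIV"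
  using assms
proof (induction n)
  case 0
  have "right_walk \<Gamma> x 0 = (\<lambda>_. \<one>\<^bsub>\<Gamma>\<^esub>)" by auto
  then show ?case by (simp del: right_walk.simps)
next
  case (Suc n)
  have "(\<lambda>\<omega>. g \<otimes>\<^bsub>\<Gamma>\<^esub> x n \<omega>) \<in> M \<rightarrow>\<^sub>M count_space UNIV" for g
    using measurable_compose[OF Suc.prems[of n], of "\<lambda>s. g \<otimes>\<^bsub>\<Gamma>\<^esub> s"] by simp
  moreover have "right_walk \<Gamma> x n \<in> M \<rightarrow>\<^sub>M count_space UNIV" using Suc by simp
  ultimately have "(\<lambda>\<omega>. right_walk \<Gamma> x n \<omega> \<otimes>\<^bsub>\<Gamma>\<^esub> x n \<omega>) \<in> M \<rightarrow>\<^sub>M count_space UNIV"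
    by (rule measurable_compose_countable)
  moreover have "right_walk \<Gamma> x (Suc n) = (\<lambda>\<omega>. right_walk \<Gamma> x n \<omega> \<otimes>\<^bsub>\<Gamma>\<^esub> x n \<omega>)" by auto
  ultimately show ?case by simp
qed

lemma right_walk_cong:
  "(\<And>m. m < n \<Longrightarrow> x m \<omega> = x' m \<omega>') \<Longrightarrow> right_walk \<Gamma> x n \<omega> = right_walk \<Gamma> x' n \<omega>'"
  by (induction n) auto

text \<open>A discrete model of the law of the walk. With finitely supported steps its expectations
  are finite sums, so integrability is automatic.\<close>

primrec walk_pmf :: "('g, 'm) monoid_scheme \<Rightarrow> 'g pmf \<Rightarrow> nat \<Rightarrow> 'g pmf" where
  "walk_pmf \<Gamma> \<mu> 0 = return_pmf \<one>\<^bsub>\<Gamma>\<^esub>"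
| "walk_pmf \<Gamma> \<mu> (Suc n) = bind_pmf (walk_pmf \<Gamma> \<mu> n) (\<lambda>g. map_pmf (\<lambda>s. g \<otimes>\<^bsub>\<Gamma>\<^esub> s) \<mu>)"

context
  fixes M :: "'w measure" and \<mu> :: "'g::countable pmf" and x :: "nat \<Rightarrow> 'w \<Rightarrow> 'g"
  assumes iid: "iid_steps M \<mu> x"
begin

interpretation prob_space M using iid by (simp add: iid_steps_def)

lemma step_measurable: "x n \<in> M \<rightarrow>\<^sub>M count_space UNIV"
  using iid by (auto simp: iid_steps_def indep_vars_def)

lemma walk_measurable: "right_walk \<Gamma> x n \<in> M \<rightarrow>\<^sub>M count_space UNIV"
  by (intro right_walk_measurable step_measurable)

lemma AE_step: "AE \<omega> in M. \<forall>n. x n \<omega> \<in> set_pmf \<mu>"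
proof (intro AE_all_countable[THEN iffD2] allI)
  fix n
  have "distr M (count_space UNIV) (x n) = measure_pmf \<mu>" using iid by (simp add: iid_steps_def)
  then have "AE s in distr M (count_space UNIV) (x n). s \<in> set_pmf \<mu>"
    by (simp only:) (simp add: AE_measure_pmf)
  then show "AE \<omega> in M. x n \<omega> \<in> set_pmf \<mu>"
    by (simp add: AE_distr_iff step_measurable)
qed

text \<open>The position at time \<open>n\<close> is a function of the steps with index below
  \<open>n\<close>.\<close>

lemma indep_walk_step: "indep_var (count_space UNIV) (right_walk \<Gamma> x n) (count_space UNIV) (x n)"
proof -
  let ?P = "\<lambda>A. PiM A (\<lambda>_::nat. count_space (UNIV :: 'g set))"
  have "indep_vars (\<lambda>_. count_space UNIV) x UNIV" using iid by (simp add: iid_steps_def)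
  then have ind: "indep_var (?P {..<n}) (\<lambda>\<omega>. restrict (\<lambda>i. x i \<omega>) {..<n}) (?P {n}) (\<lambda>\<omega>. restrict (\<lambda>i. x i \<omega>) {n})"
    by (rule indep_var_restrict) auto
  \<comment> \<open>The steps are now the coordinate maps of the product space, which exhibits the
    position as a measurable function of the vector of steps.\<close>
  have 1: "right_walk \<Gamma> (\<lambda>m f. f m) n \<in> ?P {..<n} \<rightarrow>\<^sub>M count_space UNIV"
    by (intro right_walk_measurable) (auto intro: measurable_component_singleton)
  have 2: "(\<lambda>f. f n) \<in> ?P {n} \<rightarrow>\<^sub>M count_space UNIV"
    by (intro measurable_component_singleton) auto
  have "right_walk \<Gamma> (\<lambda>m f. f m) n \<circ> (\<lambda>\<omega>. restrict (\<lambda>i. x i \<omega>) {..<n}) = right_walk \<Gamma> x n"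
    by (auto simp: fun_eq_iff intro!: right_walk_cong)
  moreover have "(\<lambda>f. f n) \<circ> (\<lambda>\<omega>. restrict (\<lambda>i. x i \<omega>) {n}) = x n" by auto
  ultimately show ?thesis using indep_var_compose[OF ind 1 2] by simp
qed

lemma distr_walk: "distr M (count_space UNIV) (right_walk \<Gamma> x n) = measure_pmf (walk_pmf \<Gamma> \<mu> n)"
proof (induction n)
  case 0
  show ?case
    by (rule measure_eqI)
       (auto simp: emeasure_distr emeasure_return_pmf emeasure_space_1 split: split_indicator)
next
  case (Suc n)
  let ?X = "right_walk \<Gamma> x n" and ?C = "count_space (UNIV :: 'g set)"
  have joint: "distr M (?C \<Otimes>\<^sub>M ?C) (\<lambda>\<omega>. (?X \<omega>, x n \<omega>)) = measure_pmf (walk_pmf \<Gamma> \<mu> n) \<Otimes>\<^sub>M measure_pmf \<mu>"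
  proof -
    have "distr M ?C (x n) = measure_pmf \<mu>" using iid by (simp add: iid_steps_def)
    then show ?thesis
      using indep_walk_step[of \<Gamma> n] Suc.IH unfolding indep_var_distribution_eq by simp
  qed
  have CC: "?C \<Otimes>\<^sub>M ?C = count_space UNIV" by (simp add: pair_measure_countable)
  have meas: "(\<lambda>\<omega>. (?X \<omega>, x n \<omega>)) \<in> M \<rightarrow>\<^sub>M ?C \<Otimes>\<^sub>M ?C"
    by (intro measurable_Pair walk_measurable step_measurable)
  have eq: "right_walk \<Gamma> x (Suc n) = (\<lambda>(g, s). g \<otimes>\<^bsub>\<Gamma>\<^esub> s) \<circ> (\<lambda>\<omega>. (?X \<omega>, x n \<omega>))" by auto
  show ?case
  proof (rule measure_eqI)
    fix A :: "'g set"
    let ?A = "{(g, s). g \<otimes>\<^bsub>\<Gamma>\<^esub> s \<in> A}"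
    have A: "?A \<in> sets (?C \<Otimes>\<^sub>M ?C)" unfolding CC by simp
    then have A': "?A \<in> sets (measure_pmf (walk_pmf \<Gamma> \<mu> n) \<Otimes>\<^sub>M measure_pmf \<mu>)"
      by (simp flip: joint)
    have "emeasure (distr M ?C (right_walk \<Gamma> x (Suc n))) A = emeasure (distr M (?C \<Otimes>\<^sub>M ?C) (\<lambda>\<omega>. (?X \<omega>, x n \<omega>))) ?A"
      using meas A walk_measurable[of \<Gamma> "Suc n"]
      by (simp add: emeasure_distr del: right_walk.simps)
         (auto intro!: arg_cong[of _ _ "emeasure M"])
    also have "\<dots> = (\<integral>\<^sup>+g. emeasure (measure_pmf \<mu>) (Pair g -` ?A) \<partial>measure_pmf (walk_pmf \<Gamma> \<mu> n))"
      unfolding joint by (rule measure_pmf.emeasure_pair_measure_alt[OF A'])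
    also have "\<dots> = emeasure (measure_pmf (walk_pmf \<Gamma> \<mu> (Suc n))) A"
      by (auto simp: emeasure_bind_pmf vimage_def intro!: nn_integral_cong)
    finally show "emeasure (distr M ?C (right_walk \<Gamma> x (Suc n))) A = emeasure (measure_pmf (walk_pmf \<Gamma> \<mu> (Suc n))) A" .
  qed simp
qed

lemma nn_integral_walk:
  "(\<integral>\<^sup>+\<omega>. F (right_walk \<Gamma> x n \<omega>) \<partial>M) = (\<integral>\<^sup>+g. F g \<partial>measure_pmf (walk_pmf \<Gamma> \<mu> n))"
  unfolding distr_walk[symmetric] by (subst nn_integral_distr) (auto intro: walk_measurable)

lemma expectation_walk:
  fixes F :: "'g \<Rightarrow> real"
  shows "(\<integral>\<omega>. F (right_walk \<Gamma> x n \<omega>) \<partial>M) = measure_pmf.expectation (walk_pmf \<Gamma> \<mu> n) F"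
  unfolding distr_walk[symmetric] by (subst integral_distr) (auto intro: walk_measurable)

end

lemma finite_set_walk_pmf: "finite (set_pmf \<mu>) \<Longrightarrow> finite (set_pmf (walk_pmf \<Gamma> \<mu> n))"
  by (induction n) auto

lemma expectation_walk_Suc:
  fixes F :: "'g \<Rightarrow> real"
  assumes "finite (set_pmf \<mu>)"
  shows "measure_pmf.expectation (walk_pmf \<Gamma> \<mu> (Suc n)) F =
    measure_pmf.expectation (walk_pmf \<Gamma> \<mu> n) (\<lambda>g. measure_pmf.expectation \<mu> (\<lambda>s. F (g \<otimes>\<^bsub>\<Gamma>\<^esub> s)))"
  using finite_set_walk_pmf[OF assms, of \<Gamma> n] assms
  by (simp add: pmf_expectation_bind integral_measure_pmf_real[of "set_pmf (walk_pmf \<Gamma> \<mu> n)"] mult.commute)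

text \<open>The series of the \<open>f n\<close> has finite expectation, hence converges almost
  surely, and its terms tend to 0.\<close>

lemma (in prob_space) AE_tendsto_0_of_summable_expectation:
  fixes f :: "nat \<Rightarrow> 'a \<Rightarrow> real"
  assumes [measurable]: "\<And>n. f n \<in> borel_measurable M"
    and nonneg: "\<And>n \<omega>. 0 \<le> f n \<omega>"
    and bound: "\<And>n. (\<integral>\<^sup>+\<omega>. f n \<omega> \<partial>M) \<le> ennreal (c n)" and c: "\<And>n. 0 \<le> c n" "summable c"
  shows "AE \<omega> in M. (\<lambda>n. f n \<omega>) \<longlonglongrightarrow> 0"
proof -
  have "(\<integral>\<^sup>+\<omega>. (\<Sum>n. ennreal (f n \<omega>)) \<partial>M) = (\<Sum>n. \<integral>\<^sup>+\<omega>. f n \<omega> \<partial>M)"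
    by (rule nn_integral_suminf) measurable
  also have "\<dots> \<le> (\<Sum>n. ennreal (c n))" by (intro suminf_le bound) auto
  also have "\<dots> < \<infinity>" using c by (simp add: suminf_ennreal2)
  finally have "AE \<omega> in M. (\<Sum>n. ennreal (f n \<omega>)) \<noteq> \<infinity>"
    by (intro nn_integral_PInf_AE) auto
  then show ?thesis
  proof eventually_elim
    case (elim \<omega>)
    then have "summable (\<lambda>n. f n \<omega>)" using nonneg by (intro summable_suminf_not_top) auto
    then show ?case by (rule summable_LIMSEQ_zero)
  qed
qed

section \<open>The drift\<close>

context
  fixes k :: nat
  assumes k: "k \<ge> 3"
begin

lemma simple_step_eq: "simple_step k = pmf_of_set {[Inl 1], [Inr 1], [Inr (int k - 1)]}"
  by (simp add: simple_step_def inv_gen_b[OF k])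

lemma set_simple_step: "set_pmf (simple_step k) = {[Inl 1], [Inr 1], [Inr (int k - 1)]}"
  unfolding simple_step_eq by (rule set_pmf_of_set) auto

lemma expectation_simple_step:
  fixes F :: "(int + int) list \<Rightarrow> real"
  shows "measure_pmf.expectation (simple_step k) F = (F [Inl 1] + F [Inr 1] + F [Inr (int k - 1)]) / 3"
  unfolding simple_step_eq using k by (subst integral_pmf_of_set) auto

lemma step_in_words: "s \<in> set_pmf (simple_step k) \<Longrightarrow> s \<in> words k"
  using k by (auto simp: set_simple_step normal_words_Cons carrier_integer_mod_group)

lemma word_mult_closed: "g \<in> words k \<Longrightarrow> s \<in> set_pmf (simple_step k) \<Longrightarrow> word_mult k g s \<in> words k"
  using step_in_words by (intro foldr_letter_mult_closed) auto

text \<open>A step can only append, delete or replace the last letter. This bounds the increments of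
  the length and later makes prefixes stabilise.\<close>

lemma word_mult_step:
  assumes w: "w \<in> words k" and s: "s \<in> set_pmf (simple_step k)"
  shows "take (length w - 1) (word_mult k w s) = take (length w - 1) w"
    and "length w \<le> length (word_mult k w s) + 1" and "length (word_mult k w s) \<le> length w + 1"
proof -
  have "take (length w - 1) (word_mult k w s) = take (length w - 1) w \<and>
    length w \<le> length (word_mult k w s) + 1 \<and> length (word_mult k w s) \<le> length w + 1"
  proof (cases "s = [Inl 1]")
    case True
    show ?thesis
    proof (cases "w = [] \<or> \<not> isl (last w)")
      case w': True
      show ?thesis using word_mult_a[OF k w w'] True by simp
    next
      case False
      then obtain g where "w = g @ [Inl 1]" "word_mult k w [Inl 1] = g" using words_ends_a[OF k w] by auto
      then show ?thesis using True by simp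
    qed
  next
    case False
    then obtain j where j: "s = [Inr j]" "j \<in> {1..<int k}" using s k by (auto simp: set_simple_step)
    obtain g i where g: "g \<in> b_open k" "w = b_power k g i" using words_cases[OF k w] .
    have "word_mult k w s = b_power k g (i + j)"
      unfolding g(2) j(1) by (rule word_mult_b_power[OF k g(1) j(2)])
    then show ?thesis unfolding g(2) by (simp add: b_power_def)
  qed
  then show "take (length w - 1) (word_mult k w s) = take (length w - 1) w"
    and "length w \<le> length (word_mult k w s) + 1" and "length (word_mult k w s) \<le> length w + 1"
    by auto
qed

lemma AE_walk_in_words:
  assumes iid: "iid_steps M (simple_step k) x"
  shows "AE \<omega> in M. \<forall>n. right_walk (Z2_Zk k) x n \<omega> \<in> words k"
  using AE_step[OF iid]
proof eventually_elim
  case (elim \<omega>)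
  have "right_walk (Z2_Zk k) x n \<omega> \<in> words k" for n
    using elim by (induction n) (auto simp: word_mult_closed)
  then show ?case by simp
qed

abbreviation walk_law :: "nat \<Rightarrow> (int + int) list pmf" where
  "walk_law \<equiv> walk_pmf (Z2_Zk k) (simple_step k)"

lemma finite_walk_law: "finite (set_pmf (walk_law n))"
  by (intro finite_set_walk_pmf) (simp add: set_simple_step)

lemma integrable_walk_law: "integrable (measure_pmf (walk_law n)) (F :: _ \<Rightarrow> real)"
  by (intro integrable_measure_pmf_finite finite_walk_law)

lemma walk_law_in_words: "g \<in> set_pmf (walk_law n) \<Longrightarrow> g \<in> words k"
  by (induction n arbitrary: g) (auto simp: word_mult_closed)

lemma expectation_walk_law_Suc:
  fixes F :: "(int + int) list \<Rightarrow> real"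
  shows "measure_pmf.expectation (walk_law (Suc n)) F = measure_pmf.expectation (walk_law n)
    (\<lambda>g. (F (word_mult k g [Inl 1]) + F (word_mult k g [Inr 1]) + F (word_mult k g [Inr (int k - 1)])) / 3)"
  using expectation_walk_Suc[of "simple_step k" "Z2_Zk k" n F]
  by (simp add: set_simple_step expectation_simple_step)

lemma expectation_walk_law_mono:
  fixes F H :: "(int + int) list \<Rightarrow> real"
  assumes "\<And>g. g \<in> words k \<Longrightarrow> F g \<le> H g"
  shows "measure_pmf.expectation (walk_law n) F \<le> measure_pmf.expectation (walk_law n) H"
  by (intro integral_mono_AE integrable_walk_law) (auto simp: AE_measure_pmf_iff intro: assms walk_law_in_words)

lemma expectation_walk_law_Suc_le:
  fixes F H :: "(int + int) list \<Rightarrow> real"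
  assumes "\<And>g. g \<in> words k \<Longrightarrow>
    F (word_mult k g [Inl 1]) + F (word_mult k g [Inr 1]) + F (word_mult k g [Inr (int k - 1)]) \<le> 3 * H g"
  shows "measure_pmf.expectation (walk_law (Suc n)) F \<le> measure_pmf.expectation (walk_law n) H"
  unfolding expectation_walk_law_Suc using assms by (intro expectation_walk_law_mono) fastforce

end

section \<open>Moment inequalities for bounded centred increments\<close>

lemma sum_centered_squares_le:
  fixes D a b c K :: real
  assumes "a + b + c = 0" "\<bar>a\<bar> \<le> K" "\<bar>b\<bar> \<le> K" "\<bar>c\<bar> \<le> K"
  shows "(D + a)\<^sup>2 + (D + b)\<^sup>2 + (D + c)\<^sup>2 \<le> 3 * (D\<^sup>2 + K\<^sup>2)"
proof -
  have "(D + a)\<^sup>2 + (D + b)\<^sup>2 + (D + c)\<^sup>2 = 3 * D\<^sup>2 + 2 * D * (a + b + c) + (a\<^sup>2 + b\<^sup>2 + c\<^sup>2)"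
    by (simp add: power2_eq_square algebra_simps)
  moreover have "a\<^sup>2 \<le> K\<^sup>2" "b\<^sup>2 \<le> K\<^sup>2" "c\<^sup>2 \<le> K\<^sup>2" using assms by (auto intro: abs_le_square_iff[THEN iffD1])
  ultimately show ?thesis using assms(1) by simp
qed

text \<open>Completing the square: \<open>8 * a^2 * D^2 + 3 * a^4\<close> exceeds the terms of
  degree at least 2 in \<open>a\<close> by exactly \<open>2 * (a * (D - a))^2\<close>.\<close>

lemma fourth_power_add_le:
  fixes D a K :: real
  assumes "\<bar>a\<bar> \<le> K"
  shows "(D + a)^4 \<le> D^4 + 4 * D^3 * a + 8 * K\<^sup>2 * D\<^sup>2 + 3 * K^4"
proof -
  have a: "a\<^sup>2 \<le> K\<^sup>2" using assms by (auto intro: abs_le_square_iff[THEN iffD1])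
  then have "a\<^sup>2 * a\<^sup>2 \<le> K\<^sup>2 * K\<^sup>2" by (intro mult_mono) auto
  then have a4: "3 * (a\<^sup>2 * a\<^sup>2) \<le> 3 * K^4" by (simp add: power2_eq_square power4_eq_xxxx)
  have aD: "8 * (a\<^sup>2 * D\<^sup>2) \<le> 8 * K\<^sup>2 * D\<^sup>2" using a by (simp add: mult_right_mono)
  have "(D + a)^4 = D^4 + 4 * D^3 * a + 8 * (a\<^sup>2 * D\<^sup>2) + 3 * (a\<^sup>2 * a\<^sup>2) - 2 * (a * (D - a))\<^sup>2"
    by (simp add: power2_eq_square power3_eq_cube power4_eq_xxxx algebra_simps)
  also have "\<dots> \<le> D^4 + 4 * D^3 * a + 8 * (a\<^sup>2 * D\<^sup>2) + 3 * (a\<^sup>2 * a\<^sup>2)" by simp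
  also have "\<dots> \<le> D^4 + 4 * D^3 * a + 8 * K\<^sup>2 * D\<^sup>2 + 3 * K^4" by (intro add_mono a4 aD order_refl)
  finally show ?thesis .
qed

lemma sum_centered_fourth_powers_le:
  fixes D a b c K :: real
  assumes "a + b + c = 0" "\<bar>a\<bar> \<le> K" "\<bar>b\<bar> \<le> K" "\<bar>c\<bar> \<le> K"
  shows "(D + a)^4 + (D + b)^4 + (D + c)^4 \<le> 3 * (D^4 + 8 * K\<^sup>2 * D\<^sup>2 + 3 * K^4)"
proof -
  have "4 * D^3 * a + 4 * D^3 * b + 4 * D^3 * c = 4 * D^3 * (a + b + c)" by (simp add: algebra_simps)
  then show ?thesis using fourth_power_add_le[OF assms(2), of D] fourth_power_add_le[OF assms(3), of D]
    fourth_power_add_le[OF assms(4), of D] assms(1) by simp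
qed

context letter_weights
begin

definition speed :: real where "speed = (1 - 2 * y) / 3"

lemma speed_pos: "0 < speed" using y by (simp add: speed_def)

abbreviation deviation :: "nat \<Rightarrow> (int + int) list \<Rightarrow> real" where
  "deviation n g \<equiv> length_potential g - real n * speed"

text \<open>The centred potential behaves as a martingale with bounded increments; \<open>a\<close>,
  \<open>b\<close>, \<open>c\<close> are its equally likely increments. The bound compares potential
  and length at both ends of a step.\<close>

lemma deviation_increments:
  obtains K where "\<And>g n. g \<in> words k \<Longrightarrow> \<exists>a b c. a + b + c = 0 \<and> \<bar>a\<bar> \<le> K \<and> \<bar>b\<bar> \<le> K \<and> \<bar>c\<bar> \<le> K \<and>
    deviation (Suc n) (word_mult k g [Inl 1]) = deviation n g + a \<and>
    deviation (Suc n) (word_mult k g [Inr 1]) = deviation n g + b \<and>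
    deviation (Suc n) (word_mult k g [Inr (int k - 1)]) = deviation n g + c"
proof -
  obtain C where C: "\<And>w. w \<in> words k \<Longrightarrow> \<bar>length_potential w - len w\<bar> \<le> C"
    using length_potential_bounded by blast
  define \<delta> where "\<delta> g s = length_potential (word_mult k g s) - length_potential g - speed" for g s
  have bound: "\<bar>\<delta> g s\<bar> \<le> 2 * C + 1 + speed" if g: "g \<in> words k" and s: "s \<in> set_pmf (simple_step k)" for g s
  proof -
    have "\<bar>len (word_mult k g s) - len g\<bar> \<le> 1" using word_mult_step[OF k g s] by auto
    then show ?thesis using C[OF g] C[OF word_mult_closed[OF k g s]] speed_pos unfolding \<delta>_def by linarith
  qed
  show ?thesis
  proof (rule that[of "2 * C + 1 + speed"])
    fix g n assume g: "g \<in> words k"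
    show "\<exists>a b c. a + b + c = 0 \<and> \<bar>a\<bar> \<le> 2 * C + 1 + speed \<and> \<bar>b\<bar> \<le> 2 * C + 1 + speed \<and> \<bar>c\<bar> \<le> 2 * C + 1 + speed \<and>
      deviation (Suc n) (word_mult k g [Inl 1]) = deviation n g + a \<and>
      deviation (Suc n) (word_mult k g [Inr 1]) = deviation n g + b \<and>
      deviation (Suc n) (word_mult k g [Inr (int k - 1)]) = deviation n g + c"
    proof (rule exI[of _ "\<delta> g [Inl 1]"], rule exI[of _ "\<delta> g [Inr 1]"], rule exI[of _ "\<delta> g [Inr (int k - 1)]"], intro conjI)
      have "3 * speed = 1 - 2 * y" by (simp add: speed_def)
      then show "\<delta> g [Inl 1] + \<delta> g [Inr 1] + \<delta> g [Inr (int k - 1)] = 0"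
        using length_potential_step[OF g] unfolding \<delta>_def by linarith
    qed (use bound[OF g] in \<open>auto simp: set_simple_step[OF k] \<delta>_def algebra_simps\<close>)
  qed
qed

text \<open>Centred increments make the second moment grow linearly, which feeds the quadratic
  growth of the fourth. After division by the fourth power of \<open>n + 1\<close> this is
  summable.\<close>

lemma deviation_fourth_moment:
  obtains Q where "0 \<le> Q"
    "\<And>n. measure_pmf.expectation (walk_law k n) (\<lambda>g. (deviation n g)^4) \<le> Q * (real n + 1)\<^sup>2"
proof -
  obtain K where K: "\<And>g n. g \<in> words k \<Longrightarrow> \<exists>a b c. a + b + c = 0 \<and> \<bar>a\<bar> \<le> K \<and> \<bar>b\<bar> \<le> K \<and> \<bar>c\<bar> \<le> K \<and>
    deviation (Suc n) (word_mult k g [Inl 1]) = deviation n g + a \<and>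
    deviation (Suc n) (word_mult k g [Inr 1]) = deviation n g + b \<and>
    deviation (Suc n) (word_mult k g [Inr (int k - 1)]) = deviation n g + c"
    using deviation_increments by blast
  define E where "E n F = measure_pmf.expectation (walk_law k n) F" for n and F :: "(int + int) list \<Rightarrow> real"
  define C where "C = length_potential []"
  define L where "L = C\<^sup>2 + K\<^sup>2"
  define Q where "Q = C^4 + 8 * K\<^sup>2 * L + 3 * K^4"
  have L0: "0 \<le> L" by (simp add: L_def)
  have Q0: "0 \<le> Q" using L0 by (simp add: Q_def)
  have m2: "E n (\<lambda>g. (deviation n g)\<^sup>2) \<le> L * (real n + 1)" for n
  proof (induction n)
    case 0
    show ?case by (simp add: E_def L_def C_def)
  next
    case (Suc n)
    have "E (Suc n) (\<lambda>g. (deviation (Suc n) g)\<^sup>2) \<le> E n (\<lambda>g. (deviation n g)\<^sup>2 + K\<^sup>2)"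
      unfolding E_def
    proof (rule expectation_walk_law_Suc_le[OF k])
      fix g assume "g \<in> words k"
      from K[OF this, of n] obtain a b c where abc: "a + b + c = 0" "\<bar>a\<bar> \<le> K" "\<bar>b\<bar> \<le> K" "\<bar>c\<bar> \<le> K"
        and eq: "deviation (Suc n) (word_mult k g [Inl 1]) = deviation n g + a"
          "deviation (Suc n) (word_mult k g [Inr 1]) = deviation n g + b"
          "deviation (Suc n) (word_mult k g [Inr (int k - 1)]) = deviation n g + c" by blast
      show "(deviation (Suc n) (word_mult k g [Inl 1]))\<^sup>2 + (deviation (Suc n) (word_mult k g [Inr 1]))\<^sup>2
        + (deviation (Suc n) (word_mult k g [Inr (int k - 1)]))\<^sup>2 \<le> 3 * ((deviation n g)\<^sup>2 + K\<^sup>2)"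
        unfolding eq by (rule sum_centered_squares_le[OF abc])
    qed
    also have "\<dots> = E n (\<lambda>g. (deviation n g)\<^sup>2) + K\<^sup>2"
      unfolding E_def by (simp add: integrable_walk_law[OF k])
    also have "\<dots> \<le> L * (real n + 1) + L" using Suc.IH by (simp add: L_def add_mono)
    finally show ?case by (simp add: algebra_simps)
  qed
  have m4: "E n (\<lambda>g. (deviation n g)^4) \<le> Q * (real n + 1)\<^sup>2" for n
  proof (induction n)
    case 0
    show ?case using L0 by (simp add: E_def Q_def C_def)
  next
    case (Suc n)
    have "E (Suc n) (\<lambda>g. (deviation (Suc n) g)^4) \<le> E n (\<lambda>g. (deviation n g)^4 + 8 * K\<^sup>2 * (deviation n g)\<^sup>2 + 3 * K^4)"
      unfolding E_def
    proof (rule expectation_walk_law_Suc_le[OF k])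
      fix g assume "g \<in> words k"
      from K[OF this, of n] obtain a b c where abc: "a + b + c = 0" "\<bar>a\<bar> \<le> K" "\<bar>b\<bar> \<le> K" "\<bar>c\<bar> \<le> K"
        and eq: "deviation (Suc n) (word_mult k g [Inl 1]) = deviation n g + a"
          "deviation (Suc n) (word_mult k g [Inr 1]) = deviation n g + b"
          "deviation (Suc n) (word_mult k g [Inr (int k - 1)]) = deviation n g + c" by blast
      show "(deviation (Suc n) (word_mult k g [Inl 1]))^4 + (deviation (Suc n) (word_mult k g [Inr 1]))^4
        + (deviation (Suc n) (word_mult k g [Inr (int k - 1)]))^4
        \<le> 3 * ((deviation n g)^4 + 8 * K\<^sup>2 * (deviation n g)\<^sup>2 + 3 * K^4)"
        unfolding eq by (rule sum_centered_fourth_powers_le[OF abc])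
    qed
    also have "\<dots> = E n (\<lambda>g. (deviation n g)^4) + 8 * K\<^sup>2 * E n (\<lambda>g. (deviation n g)\<^sup>2) + 3 * K^4"
      unfolding E_def by (simp add: integrable_walk_law[OF k])
    also have "\<dots> \<le> Q * (real n + 1)\<^sup>2 + 8 * K\<^sup>2 * (L * (real n + 1)) + 3 * K^4"
      using Suc.IH m2[of n] by (intro add_mono mult_left_mono) auto
    also have "\<dots> \<le> Q * (real n + 1)\<^sup>2 + Q * (real n + 1)"
    proof -
      have "3 * K^4 * 1 \<le> 3 * K^4 * (real n + 1)" by (intro mult_left_mono) auto
      moreover have "0 \<le> C^4 * (real n + 1)" by simp
      ultimately show ?thesis by (simp add: Q_def algebra_simps)
    qed
    also have "\<dots> \<le> Q * (real (Suc n) + 1)\<^sup>2"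
      using mult_left_mono[OF _ Q0, of "(real n + 1)\<^sup>2 + (real n + 1)" "(real (Suc n) + 1)\<^sup>2"]
      by (simp add: power2_eq_square algebra_simps)
    finally show ?case .
  qed
  show ?thesis using that[OF Q0] m4 by (simp add: E_def)
qed

theorem AE_speed:
  assumes iid: "iid_steps M (simple_step k) x"
  shows "AE \<omega> in M. (\<lambda>n. real (length (right_walk (Z2_Zk k) x n \<omega>)) / real n) \<longlonglongrightarrow> speed"
proof -
  interpret prob_space M using iid by (simp add: iid_steps_def)
  let ?X = "right_walk (Z2_Zk k) x"
  note meas = walk_measurable[OF iid, of "Z2_Zk k"]
  obtain C where C: "\<And>w. w \<in> words k \<Longrightarrow> \<bar>length_potential w - len w\<bar> \<le> C"
    using length_potential_bounded by blast
  obtain Q where Q: "0 \<le> Q"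
    "\<And>n. measure_pmf.expectation (walk_law k n) (\<lambda>g. (deviation n g)^4) \<le> Q * (real n + 1)\<^sup>2"
    using deviation_fourth_moment by blast
  \<comment> \<open>Dividing by \<open>n + 1\<close> makes the moment bound usable at
    \<open>n = 0\<close> too; the factor \<open>(n + 1) / n\<close>, which tends to 1, restores the
    denominator \<open>n\<close> afterwards.\<close>
  have "AE \<omega> in M. (\<lambda>n. (deviation n (?X n \<omega>) / (real n + 1))^4) \<longlonglongrightarrow> 0"
  proof (rule AE_tendsto_0_of_summable_expectation)
    fix n
    show "(\<lambda>\<omega>. (deviation n (?X n \<omega>) / (real n + 1))^4) \<in> borel_measurable M"
      by (rule measurable_compose[OF meas]) simp
    have "(\<integral>\<^sup>+\<omega>. (deviation n (?X n \<omega>) / (real n + 1))^4 \<partial>M)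
        = (\<integral>\<^sup>+g. (deviation n g / (real n + 1))^4 \<partial>measure_pmf (walk_law k n))"
      by (rule nn_integral_walk[OF iid, where F = "\<lambda>g. ennreal ((deviation n g / (real n + 1))^4)"])
    also have "\<dots> = ennreal (measure_pmf.expectation (walk_law k n) (\<lambda>g. (deviation n g / (real n + 1))^4))"
      by (intro nn_integral_eq_integral integrable_walk_law[OF k]) auto
    also have "\<dots> \<le> ennreal (Q * (1 / (real n + 1)\<^sup>2))"
    proof (rule ennreal_leI)
      have "measure_pmf.expectation (walk_law k n) (\<lambda>g. (deviation n g / (real n + 1))^4)
          = measure_pmf.expectation (walk_law k n) (\<lambda>g. (deviation n g)^4) / (real n + 1)^4"
        by (simp add: power_divide)
      also have "\<dots> \<le> Q * (real n + 1)\<^sup>2 / (real n + 1)^4"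
        using Q by (intro divide_right_mono) auto
      also have "\<dots> = Q * (1 / (real n + 1)\<^sup>2)"
      proof -
        have "Q * z\<^sup>2 / z^4 = Q * (1 / z\<^sup>2)" if "z \<noteq> 0" for z :: real
          using that by (simp add: field_simps power4_eq_xxxx power2_eq_square)
        then show ?thesis by (simp add: add_pos_nonneg)
      qed
      finally show "measure_pmf.expectation (walk_law k n) (\<lambda>g. (deviation n g / (real n + 1))^4) \<le> Q * (1 / (real n + 1)\<^sup>2)" .
    qed
    finally show "(\<integral>\<^sup>+\<omega>. (deviation n (?X n \<omega>) / (real n + 1))^4 \<partial>M) \<le> ennreal (Q * (1 / (real n + 1)\<^sup>2))" .
  next
    have "summable (\<lambda>n. 1 / (real (Suc n))\<^sup>2)"
      using inverse_power_summable[of 2, where 'a = real] summable_Suc_iff[of "\<lambda>n. inverse ((real n)\<^sup>2)"]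
      by (simp add: inverse_eq_divide)
    then show "summable (\<lambda>n. Q * (1 / (real n + 1)\<^sup>2))"
      by (intro summable_mult) (simp add: add.commute)
  qed (use Q in auto)
  moreover note AE_walk_in_words[OF k iid]
  ultimately show ?thesis
  proof eventually_elim
    case (elim \<omega>)
    let ?D = "\<lambda>n. deviation n (?X n \<omega>) / (real n + 1)"
    have "?D \<longlonglongrightarrow> 0" using elim(1) by (subst (asm) power_tendsto_0_iff) auto
    moreover have "(\<lambda>n. (real n + 1) / real n) \<longlonglongrightarrow> 1"
      using LIMSEQ_Suc_n_over_n[where 'a = real] by (simp add: add.commute)
    ultimately have "(\<lambda>n. ?D n * ((real n + 1) / real n)) \<longlonglongrightarrow> 0 * 1" by (rule tendsto_mult)
    moreover have "(\<lambda>n. (len (?X n \<omega>) - length_potential (?X n \<omega>)) / real n) \<longlonglongrightarrow> 0"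
    proof (rule Lim_null_comparison)
      show "\<forall>\<^sub>F n in sequentially. norm ((len (?X n \<omega>) - length_potential (?X n \<omega>)) / real n) \<le> C / real n"
      proof (intro always_eventually allI)
        fix n
        have "\<bar>len (?X n \<omega>) - length_potential (?X n \<omega>)\<bar> \<le> C"
          using C[of "?X n \<omega>"] elim(2) by (simp add: abs_minus_commute del: right_walk.simps)
        then show "norm ((len (?X n \<omega>) - length_potential (?X n \<omega>)) / real n) \<le> C / real n"
          by (simp add: abs_divide divide_right_mono)
      qed
      show "(\<lambda>n. C / real n) \<longlonglongrightarrow> 0" by (rule lim_const_over_n)
    qed
    ultimately have "(\<lambda>n. ?D n * ((real n + 1) / real n)
        + (len (?X n \<omega>) - length_potential (?X n \<omega>)) / real n + speed) \<longlonglongrightarrow> 0 * 1 + 0 + speed"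
      by (intro tendsto_add tendsto_const)
    moreover have "\<forall>\<^sub>F n in sequentially. ?D n * ((real n + 1) / real n)
        + (len (?X n \<omega>) - length_potential (?X n \<omega>)) / real n + speed = len (?X n \<omega>) / real n"
      using eventually_gt_at_top[of 0]
    proof eventually_elim
      case (elim n)
      have "?D n * ((real n + 1) / real n) = deviation n (?X n \<omega>) / real n" by simp
      then show ?case using elim by (simp add: diff_divide_distrib)
    qed
    ultimately have "(\<lambda>n. len (?X n \<omega>) / real n) \<longlonglongrightarrow> 0 * 1 + 0 + speed"
      by (rule Lim_transform_eventually)
    then show ?case by simp
  qed
qed

end

section \<open>The limit word and its law\<close>

lemma le_common_prefix_length_iff:
  "m \<le> common_prefix_length w s \<longleftrightarrow> m \<le> length w \<and> take m w = stake m s"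
proof
  let ?p = "longest_common_prefix w (stake (length w) s)"
  assume m: "m \<le> common_prefix_length w s"
  have 1: "?p = take (length ?p) w" "?p = take (length ?p) (stake (length w) s)"
    using longest_common_prefix_prefix1 longest_common_prefix_prefix2 by (metis append_eq_conv_conj prefix_def)+
  have le: "length ?p \<le> length w" using longest_common_prefix_prefix1 prefix_length_le by blast
  have "take m w = take m ?p" "take m (stake (length w) s) = take m ?p"
    using 1 m by (metis common_prefix_length_def min.absorb1 take_take)+
  then show "m \<le> length w \<and> take m w = stake m s"
    using m le by (auto simp: common_prefix_length_def take_stake min_def)
next
  assume m: "m \<le> length w \<and> take m w = stake m s"
  have "prefix (take m w) (stake (length w) s)"
    using m by (metis min.absorb1 take_is_prefix take_stake)
  then have "prefix (take m w) (longest_common_prefix w (stake (length w) s))"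
    by (intro longest_common_prefix_max_prefix take_is_prefix)
  then show "m \<le> common_prefix_length w s"
    using m by (auto simp: common_prefix_length_def dest: prefix_length_le)
qed

lemma filterlim_common_prefix_length_iff:
  "filterlim (\<lambda>n. common_prefix_length (X n) s) at_top sequentially \<longleftrightarrow>
     (\<forall>m. \<forall>\<^sub>F n in sequentially. m \<le> length (X n) \<and> take m (X n) = stake m s)"
  by (simp add: filterlim_at_top le_common_prefix_length_iff)

lemma limit_stream_unique:
  assumes "filterlim (\<lambda>n. common_prefix_length (X n) s) at_top sequentially"
    and "filterlim (\<lambda>n. common_prefix_length (X n) s') at_top sequentially"
  shows "s = s'"
proof -
  have st: "stake m s = stake m s'" for m
  proof -
    have "\<forall>\<^sub>F n in sequentially. take m (X n) = stake m s \<and> take m (X n) = stake m s'"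
      using assms[unfolded filterlim_common_prefix_length_iff, rule_format, of m] by eventually_elim simp
    then show ?thesis by (auto dest: eventually_happens)
  qed
  have "s !! i = s' !! i" for i using st[of "Suc i"] by (metis lessI stake_nth)
  then have "(!!) s = (!!) s'" by (rule ext)
  then show ?thesis by (metis stream_smap_nats)
qed

section \<open>A measurable version of the limit word\<close>

definition limit_letter :: "'l set \<Rightarrow> 'l \<Rightarrow> (nat \<Rightarrow> 'l list) \<Rightarrow> nat \<Rightarrow> 'l" where
  "limit_letter S u\<^sub>0 X i =
     (if \<exists>u\<in>S. \<forall>\<^sub>F n in sequentially. i < length (X n) \<and> X n ! i = u
      then THE u. \<forall>\<^sub>F n in sequentially. i < length (X n) \<and> X n ! i = u else u\<^sub>0)"

lemma limit_letter_eqI: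
  assumes "u \<in> S" "\<forall>\<^sub>F n in sequentially. i < length (X n) \<and> X n ! i = u"
  shows "limit_letter S u\<^sub>0 X i = u"
proof -
  have uniq: "v = u" if "\<forall>\<^sub>F n in sequentially. i < length (X n) \<and> X n ! i = v" for v
  proof -
    have "\<forall>\<^sub>F n in sequentially. v = u" using that assms(2) by eventually_elim auto
    then show ?thesis by (auto dest: eventually_happens)
  qed
  have "(THE u. \<forall>\<^sub>F n in sequentially. i < length (X n) \<and> X n ! i = u) = u"
  proof (rule the_equality)
    show "\<forall>\<^sub>F n in sequentially. i < length (X n) \<and> X n ! i = u" by (fact assms(2))
  qed (fact uniq)
  then show ?thesis using assms by (auto simp: limit_letter_def)
qed

lemma limit_letter_in:
  assumes "u\<^sub>0 \<in> S"
  shows "limit_letter S u\<^sub>0 X i \<in> S"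
proof (cases "\<exists>u\<in>S. \<forall>\<^sub>F n in sequentially. i < length (X n) \<and> X n ! i = u")
  case True
  then obtain u where "u \<in> S" "\<forall>\<^sub>F n in sequentially. i < length (X n) \<and> X n ! i = u" by blast
  then show ?thesis using limit_letter_eqI[of u S i X u\<^sub>0] by simp
qed (use assms in \<open>simp add: limit_letter_def\<close>)

text \<open>Describes the fibres by countable combinations of events on the walk, without the
  definite description, as the measurability proof requires.\<close>

lemma limit_letter_eq_iff:
  assumes "u\<^sub>0 \<in> S"
  shows "limit_letter S u\<^sub>0 X i = u \<longleftrightarrow>
    (u \<in> S \<and> (\<forall>\<^sub>F n in sequentially. i < length (X n) \<and> X n ! i = u)) \<or>
    (u = u\<^sub>0 \<and> (\<forall>v\<in>S. \<not> (\<forall>\<^sub>F n in sequentially. i < length (X n) \<and> X n ! i = v)))"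
proof (cases "\<exists>v\<in>S. \<forall>\<^sub>F n in sequentially. i < length (X n) \<and> X n ! i = v")
  case True
  then obtain v where v: "v \<in> S" "\<forall>\<^sub>F n in sequentially. i < length (X n) \<and> X n ! i = v" by blast
  then have "limit_letter S u\<^sub>0 X i = v" by (intro limit_letter_eqI)
  then show ?thesis using v limit_letter_eqI[of u S i X u\<^sub>0] by blast
next
  case False
  then show ?thesis by (auto simp: limit_letter_def)
qed

lemma limit_letter_measurable:
  fixes X :: "nat \<Rightarrow> 'w \<Rightarrow> 'l::countable list"
  assumes X [measurable]: "\<And>n. X n \<in> M \<rightarrow>\<^sub>M count_space UNIV" and u0: "u\<^sub>0 \<in> S"
  shows "(\<lambda>\<omega>. limit_letter S u\<^sub>0 (\<lambda>n. X n \<omega>) i) \<in> M \<rightarrow>\<^sub>M count_space S"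
proof (subst measurable_count_space_eq_countable)
  show "countable S" by simp
  have ev: "{\<omega> \<in> space M. \<forall>\<^sub>F n in sequentially. i < length (X n \<omega>) \<and> X n \<omega> ! i = u} \<in> sets M" for u
  proof -
    have "{\<omega> \<in> space M. i < length (X n \<omega>) \<and> X n \<omega> ! i = u} \<in> sets M" for n
    proof -
      have "X n -` {w. i < length w \<and> w ! i = u} \<inter> space M \<in> sets M"
        by (rule measurable_sets[OF X]) simp
      also have "X n -` {w. i < length w \<and> w ! i = u} \<inter> space M =
          {\<omega> \<in> space M. i < length (X n \<omega>) \<and> X n \<omega> ! i = u}" by blast
      finally show ?thesis .
    qed
    then show ?thesis unfolding eventually_sequentially
      by (intro sets.sets_Collect_countable_Ex sets.sets_Collect_countable_All sets.sets_Collect_imp sets.sets_Collect_const)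
  qed
  have "(\<lambda>\<omega>. limit_letter S u\<^sub>0 (\<lambda>n. X n \<omega>) i) -` {u} \<inter> space M \<in> sets M" for u
  proof -
    have "(\<lambda>\<omega>. limit_letter S u\<^sub>0 (\<lambda>n. X n \<omega>) i) -` {u} \<inter> space M =
      {\<omega> \<in> space M. limit_letter S u\<^sub>0 (\<lambda>n. X n \<omega>) i = u}" by auto
    also have "\<dots> = {\<omega> \<in> space M. (u \<in> S \<and> (\<forall>\<^sub>F n in sequentially. i < length (X n \<omega>) \<and> X n \<omega> ! i = u)) \<or>
        (u = u\<^sub>0 \<and> (\<forall>v\<in>S. \<not> (\<forall>\<^sub>F n in sequentially. i < length (X n \<omega>) \<and> X n \<omega> ! i = v)))}"
      by (simp only: limit_letter_eq_iff[OF u0])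
    also have "\<dots> \<in> sets M"
    proof -
      have "{\<omega> \<in> space M. \<forall>v\<in>S. \<not> (\<forall>\<^sub>F n in sequentially. i < length (X n \<omega>) \<and> X n \<omega> ! i = v)} \<in> sets M"
        by (rule sets.sets_Collect_countable_Ball[OF sets.sets_Collect_neg[OF ev]])
      then show ?thesis using ev[of u] by (intro sets.sets_Collect_disj sets.sets_Collect_conj sets.sets_Collect_const)
    qed
    finally show ?thesis .
  qed
  then show "(\<lambda>\<omega>. limit_letter S u\<^sub>0 (\<lambda>n. X n \<omega>) i) \<in> space M \<rightarrow> S \<and>
     (\<forall>a\<in>S. (\<lambda>\<omega>. limit_letter S u\<^sub>0 (\<lambda>n. X n \<omega>) i) -` {a} \<inter> space M \<in> sets M)"
    using limit_letter_in[OF u0] by auto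
qed

text \<open>A step leaves all but the last letter in place, so the first \<open>m\<close> letters
  are frozen once the length stays above \<open>m\<close>.\<close>

lemma stabilising_prefixes:
  assumes step: "\<And>n. take (length (X n) - 1) (X (Suc n)) = take (length (X n) - 1) (X n)"
    and len: "\<forall>\<^sub>F n in sequentially. m < length (X n)"
  shows "\<exists>N. \<forall>n\<ge>N. m < length (X n) \<and> take m (X n) = take m (X N)"
proof -
  obtain N where N: "\<forall>n\<ge>N. m < length (X n)"
    using len unfolding eventually_sequentially by blast
  have "take m (X (N + n)) = take m (X N)" for n
  proof (induction n)
    case (Suc n)
    have "m < length (X (N + n))" using N by simp
    then have m: "min m (length (X (N + n)) - 1) = m" by linarith
    have "take m (X (Suc (N + n))) = take m (take (length (X (N + n)) - 1) (X (Suc (N + n))))"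
      by (simp only: take_take m)
    also have "\<dots> = take m (X (N + n))" by (simp only: step take_take m)
    finally show ?case using Suc by (simp only: add_Suc_right)
  qed simp
  then show ?thesis using N by (metis le_add_diff_inverse)
qed

lemma limit_stream_exists:
  fixes X :: "nat \<Rightarrow> ('a + 'b) list" and u\<^sub>0 :: "'a + 'b"
  assumes step: "\<And>n. take (length (X n) - 1) (X (Suc n)) = take (length (X n) - 1) (X n)"
    and len: "\<And>m. \<forall>\<^sub>F n in sequentially. m < length (X n)"
    and words: "\<And>n. X n \<in> normal_words G H"
  defines "s \<equiv> to_stream (limit_letter (letters G H) u\<^sub>0 X)"
  shows "s \<in> infinite_normal_words G H"
    and "filterlim (\<lambda>n. common_prefix_length (X n) s) at_top sequentially"
proof -
  have snth: "s !! i = limit_letter (letters G H) u\<^sub>0 X i" for i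
    by (simp add: s_def to_stream_def)
  have pre: "\<exists>N. \<forall>n\<ge>N. m < length (X n) \<and> take m (X n) = stake m s" for m
  proof -
    obtain N where "\<forall>n\<ge>N. m < length (X n) \<and> take m (X n) = take m (X N)"
      using stabilising_prefixes[of X m, OF step len[of m]] by blast
    then have N: "\<And>n. N \<le> n \<Longrightarrow> m < length (X n)" "\<And>n. N \<le> n \<Longrightarrow> take m (X n) = take m (X N)"
      by blast+
    have "s !! i = X N ! i" if i: "i < m" for i
      unfolding snth
    proof (rule limit_letter_eqI)
      have "X N ! i \<in> set (X N)" using N(1)[of N] i by simp
      then show "X N ! i \<in> letters G H" using words[of N] by (auto simp: normal_words_def)
      show "\<forall>\<^sub>F n in sequentially. i < length (X n) \<and> X n ! i = X N ! i"
        unfolding eventually_sequentially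
      proof (intro exI allI impI)
        fix n assume n: "N \<le> n"
        have "X n ! i = X N ! i" using arg_cong[OF N(2)[OF n], of "\<lambda>w. w ! i"] i by simp
        then show "i < length (X n) \<and> X n ! i = X N ! i" using N(1)[OF n] i by simp
      qed
    qed
    then have st: "take m (X N) = stake m s" using N(1)[of N] by (intro nth_equalityI) auto
    show ?thesis
    proof (intro exI allI impI)
      fix n assume "N \<le> n"
      then show "m < length (X n) \<and> take m (X n) = stake m s" using N(1)[of n] N(2)[of n] st by simp
    qed
  qed
  show "filterlim (\<lambda>n. common_prefix_length (X n) s) at_top sequentially"
    unfolding filterlim_common_prefix_length_iff eventually_sequentially
  proof
    fix m
    obtain N where "\<forall>n\<ge>N. m < length (X n) \<and> take m (X n) = stake m s" using pre[of m] by blast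
    then have "\<forall>n\<ge>N. m \<le> length (X n) \<and> take m (X n) = stake m s" by (simp add: less_imp_le)
    then show "\<exists>N. \<forall>n\<ge>N. m \<le> length (X n) \<and> take m (X n) = stake m s" ..
  qed
  have "s !! i \<in> letters G H \<and> isl (s !! i) \<noteq> isl (s !! Suc i)" for i
  proof -
    \<comment> \<open>A common prefix of length \<open>i + 2\<close> contains both positions
      \<open>i\<close> and \<open>i + 1\<close>, which gives the alternation there.\<close>
    obtain n where n: "Suc (Suc i) < length (X n)" "take (Suc (Suc i)) (X n) = stake (Suc (Suc i)) s"
      using pre[of "Suc (Suc i)"] by blast
    have st: "s !! j = X n ! j" if "j < Suc (Suc i)" for j
      using that arg_cong[OF n(2), of "\<lambda>w. w ! j"] by (simp del: stake.simps take_Suc_Cons)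
    have eq: "s !! i = X n ! i" "s !! Suc i = X n ! Suc i" by (rule st, simp)+
    have "X n ! i \<in> set (X n)" using n(1) by simp
    then have "X n ! i \<in> letters G H" using words[of n] by (auto simp: normal_words_def)
    moreover have "successively (\<lambda>u v. isl u \<noteq> isl v) (X n)" using words[of n] by (simp add: normal_words_def)
    then have "isl (X n ! i) \<noteq> isl (X n ! Suc i)" using n(1) unfolding successively_conv_nth by simp
    ultimately show ?thesis unfolding eq by blast
  qed
  then show "s \<in> infinite_normal_words G H"
    unfolding infinite_normal_words_def streams_iff_snth by blast
qed

lemma sstart_in_sets:
  assumes S: "countable S" and w: "w \<in> lists S"
  shows "sstart S w \<in> sets (stream_space (count_space S))"
proof -
  have "sstart S ` lists S \<union> {{}} \<subseteq> Pow (streams S)"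
    by (simp add: image_subset_iff sstart_in_streams)
  then show ?thesis
    unfolding sets_stream_space_sstart[OF S] using w by (simp add: sigma_sets.Basic sets_measure_of)
qed

lemma (in prob_space) limit_word_unique_AE:
  assumes "is_limit_word G H M X Y" "is_limit_word G H M X Y'"
  shows "AE \<omega> in M. Y \<omega> = Y' \<omega>"
  using assms[unfolded is_limit_word_def, THEN conjunct2]
proof eventually_elim
  case (elim \<omega>)
  show ?case by (rule limit_stream_unique[OF elim(1)[THEN conjunct2] elim(2)[THEN conjunct2]])
qed

text \<open>Two limit words agree almost surely, so they have the same law.\<close>

lemma (in prob_space) ex1_harmonic_measure:
  assumes "is_limit_word G H M X Y"
  shows "\<exists>!\<nu>. is_harmonic_measure G H M X \<nu>"
proof
  show "is_harmonic_measure G H M X (distr M (stream_space (count_space (letters G H))) Y)"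
    unfolding is_harmonic_measure_def using assms by blast
  fix \<nu> assume "is_harmonic_measure G H M X \<nu>"
  then obtain Y' where Y': "is_limit_word G H M X Y'" "\<nu> = distr M (stream_space (count_space (letters G H))) Y'"
    unfolding is_harmonic_measure_def by blast
  show "\<nu> = distr M (stream_space (count_space (letters G H))) Y"
    unfolding Y'(2)
  proof (rule distr_cong_AE)
    show "AE \<omega> in M. Y' \<omega> = Y \<omega>" by (rule limit_word_unique_AE[OF Y'(1) assms])
  qed (use Y'(1) assms in \<open>simp_all add: is_limit_word_def\<close>)
qed

lemma drift_eq:
  assumes "prob_space M" "AE \<omega> in M. (\<lambda>n. real (length (X n \<omega>)) / real n) \<longlonglongrightarrow> c"
  shows "drift M X = c"
  unfolding drift_def
proof (rule the_equality)
  interpret prob_space M by fact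
  fix c' assume "AE \<omega> in M. (\<lambda>n. real (length (X n \<omega>)) / real n) \<longlonglongrightarrow> c'"
  then have "AE \<omega> in M. c' = c" using assms(2) by eventually_elim (rule LIMSEQ_unique)
  then show "c' = c" by simp
qed fact

section \<open>Existence of the limit word and identification of its law\<close>

context letter_weights
begin

abbreviation Sigma_letters :: "(int + int) set" where
  "Sigma_letters \<equiv> letters (integer_mod_group 2) (integer_mod_group k)"

context
  fixes M :: "'w measure" and x :: "nat \<Rightarrow> 'w \<Rightarrow> (int + int) list"
  assumes iid: "iid_steps M (simple_step k) x"
begin

interpretation prob_space M using iid by (simp add: iid_steps_def)

abbreviation X :: "nat \<Rightarrow> 'w \<Rightarrow> (int + int) list" where
  "X \<equiv> right_walk (Z2_Zk k) x"

text \<open>Positive speed makes the length tend to infinity almost surely; as steps change only the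
  last letter, all prefixes then stabilise.\<close>

lemma ex_limit_word:
  "is_limit_word (integer_mod_group 2) (integer_mod_group k) M X
     (\<lambda>\<omega>. to_stream (limit_letter Sigma_letters (Inl 1) (\<lambda>n. X n \<omega>)))"
  unfolding is_limit_word_def
proof (intro conjI)
  have u0: "Inl 1 \<in> Sigma_letters" using k by (simp add: letters_Z2_Zk)
  show "(\<lambda>\<omega>. to_stream (limit_letter Sigma_letters (Inl 1) (\<lambda>n. X n \<omega>)))
      \<in> M \<rightarrow>\<^sub>M stream_space (count_space Sigma_letters)"
    by (rule measurable_stream_space2)
       (simp add: to_stream_def limit_letter_measurable walk_measurable[OF iid] u0)
  show "AE \<omega> in M. to_stream (limit_letter Sigma_letters (Inl 1) (\<lambda>n. X n \<omega>))
        \<in> infinite_normal_words (integer_mod_group 2) (integer_mod_group k) \<and>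
      filterlim (\<lambda>n. common_prefix_length (X n \<omega>)
        (to_stream (limit_letter Sigma_letters (Inl 1) (\<lambda>n. X n \<omega>)))) at_top sequentially"
    using AE_speed[OF iid] AE_walk_in_words[OF k iid] AE_step[OF iid]
  proof eventually_elim
    case (elim \<omega>)
    have step: "take (length (X n \<omega>) - 1) (X (Suc n) \<omega>) = take (length (X n \<omega>) - 1) (X n \<omega>)" for n
      using word_mult_step(1)[OF k, of "X n \<omega>" "x n \<omega>"] elim by simp
    have "\<forall>\<^sub>F n in sequentially. m < length (X n \<omega>)" for m
    proof -
      have "filterlim (\<lambda>n. real (length (X n \<omega>)) / real n * real n) at_top sequentially"
        by (rule filterlim_tendsto_pos_mult_at_top[OF elim(1) speed_pos filterlim_real_sequentially])
      then have "\<forall>\<^sub>F n in sequentially. real m < real (length (X n \<omega>)) / real n * real n"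
        by (simp only: filterlim_at_top_dense)
      then show ?thesis using eventually_gt_at_top[of 0] by eventually_elim simp
    qed
    then show ?case
      using limit_stream_exists[of "\<lambda>n. X n \<omega>" "integer_mod_group 2" "integer_mod_group k" "Inl 1"] step elim(2)
      by simp
  qed
qed

lemma expectation_cylinder_potential:
  assumes w: "w \<in> words k"
  shows "(\<integral>\<omega>. cylinder_potential w (X n \<omega>) \<partial>M) = cylinder_potential w []"
  unfolding expectation_walk[OF iid]
proof (induction n)
  case (Suc n)
  have "measure_pmf.expectation (walk_law k (Suc n)) (cylinder_potential w) =
      measure_pmf.expectation (walk_law k n) (cylinder_potential w)"
    unfolding expectation_walk_law_Suc[OF k]
    by (intro integral_cong_AE)
       (auto simp: AE_measure_pmf_iff cylinder_potential_step[OF w] walk_law_in_words[OF k])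
  then show ?case using Suc by simp
qed simp

text \<open>Along the walk the cylinder potential converges almost surely to the indicator that the
  limit word starts with \<open>w\<close>. Its expectation is constant by harmonicity, so dominated
  convergence identifies the probability.\<close>

lemma prob_limit_word_starts:
  assumes Y: "is_limit_word (integer_mod_group 2) (integer_mod_group k) M X Y"
    and w: "w \<in> words k"
  shows "prob (Y -` sstart Sigma_letters w \<inter> space M) = cylinder_potential w []"
proof -
  let ?A = "Y -` sstart Sigma_letters w \<inter> space M"
  have Ym: "Y \<in> M \<rightarrow>\<^sub>M stream_space (count_space Sigma_letters)" using Y by (simp add: is_limit_word_def)
  have "sstart Sigma_letters w \<in> sets (stream_space (count_space Sigma_letters))"
    using w by (intro sstart_in_sets) (auto simp: normal_words_def)
  then have A: "?A \<in> sets M" using Ym by (rule measurable_sets[rotated])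
  have "AE \<omega> in M. (\<lambda>n. cylinder_potential w (X n \<omega>)) \<longlonglongrightarrow> indicator ?A \<omega>"
  proof -
    have "AE \<omega> in M. filterlim (\<lambda>n. common_prefix_length (X n \<omega>) (Y \<omega>)) at_top sequentially"
      using Y by (simp add: is_limit_word_def)
    with AE_walk_in_words[OF k iid] AE_space show ?thesis
    proof eventually_elim
      case (elim \<omega>)
      have Ys: "Y \<omega> \<in> streams Sigma_letters"
        using measurable_space[OF Ym elim(2)] by (simp add: space_stream_space)
      have ev: "\<forall>\<^sub>F n in sequentially. m \<le> length (X n \<omega>) \<and> take m (X n \<omega>) = stake m (Y \<omega>)" for m
        using elim(3) unfolding filterlim_common_prefix_length_iff by blast
      have ind: "(if prefix w (X n \<omega>) then 1 else 0) = (indicator ?A \<omega> :: real)"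
        if "length w \<le> length (X n \<omega>)" "take (length w) (X n \<omega>) = stake (length w) (Y \<omega>)" for n
      proof -
        have "prefix w (X n \<omega>) \<longleftrightarrow> stake (length w) (Y \<omega>) = w"
          using that by (metis append_eq_conv_conj prefix_def take_is_prefix)
        also have "\<dots> \<longleftrightarrow> (\<forall>i<length w. Y \<omega> !! i = w ! i)"
          by (metis length_stake nth_equalityI stake_nth)
        also have "\<dots> \<longleftrightarrow> \<omega> \<in> ?A" using elim(2) sstart_eq[OF Ys] by simp
        finally show ?thesis by simp
      qed
      have lim: "(\<lambda>n. theta ^ ((length (X n \<omega>) - length w) div 2)) \<longlonglongrightarrow> 0"
      proof (rule filterlim_compose[OF LIMSEQ_power_zero])
        show "norm theta < 1" using theta by simp
        show "filterlim (\<lambda>n. (length (X n \<omega>) - length w) div 2) sequentially sequentially"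
          unfolding filterlim_at_top
        proof
          fix m
          show "\<forall>\<^sub>F n in sequentially. m \<le> (length (X n \<omega>) - length w) div 2"
            using ev[of "2 * m + length w"] by eventually_elim linarith
        qed
      qed
      have "(\<lambda>n. cylinder_potential w (X n \<omega>) - indicator ?A \<omega>) \<longlonglongrightarrow> 0"
      proof (rule Lim_null_comparison[OF _ lim])
        show "\<forall>\<^sub>F n in sequentially. norm (cylinder_potential w (X n \<omega>) - indicator ?A \<omega>)
            \<le> theta ^ ((length (X n \<omega>) - length w) div 2)"
          using ev[of "length w"]
        proof eventually_elim
          case (elim n)
          then show ?case
            using cylinder_potential_approx[OF w, of "X n \<omega>"] ind[of n] \<open>\<forall>n. X n \<omega> \<in> words k\<close> by simp
        qed
      qed
      then show ?case by (simp only: LIM_zero_iff)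
    qed
  qed
  moreover have "AE \<omega> in M. norm (cylinder_potential w (X n \<omega>)) \<le> 1" for n
    using AE_walk_in_words[OF k iid]
  proof eventually_elim
    case (elim \<omega>)
    then show ?case using cylinder_potential_bounds[OF w, of "X n \<omega>"] by simp
  qed
  moreover have "(\<lambda>\<omega>. cylinder_potential w (X n \<omega>)) \<in> borel_measurable M" for n
    by (rule measurable_compose[OF walk_measurable[OF iid]]) simp
  ultimately have "(\<lambda>n. \<integral>\<omega>. cylinder_potential w (X n \<omega>) \<partial>M) \<longlonglongrightarrow> (\<integral>\<omega>. indicator ?A \<omega> \<partial>M)"
    using A by (intro integral_dominated_convergence[where w = "\<lambda>_. 1"]) auto
  then have "(\<lambda>n. cylinder_potential w []) \<longlonglongrightarrow> prob ?A"
    using A by (simp add: expectation_cylinder_potential[OF w])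
  then show ?thesis by (simp add: LIMSEQ_const_iff)
qed

lemma harmonic_measure_markovian:
  assumes \<nu>: "is_harmonic_measure (integer_mod_group 2) (integer_mod_group k) M X \<nu>"
    and R: "R (Inl 1) = r" "\<And>i. i \<in> {1..<int k} \<Longrightarrow> R (Inr i) = rho i"
  shows "markovian_multiplicative (integer_mod_group 2) (integer_mod_group k) R \<nu>"
  unfolding markovian_multiplicative_def
proof (intro conjI ballI impI)
  obtain Y where Y: "is_limit_word (integer_mod_group 2) (integer_mod_group k) M X Y"
    and \<nu>_eq: "\<nu> = distr M (stream_space (count_space Sigma_letters)) Y"
    using \<nu> by (auto simp: is_harmonic_measure_def)
  have Ym: "Y \<in> M \<rightarrow>\<^sub>M stream_space (count_space Sigma_letters)" using Y by (simp add: is_limit_word_def)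
  have L: "Sigma_letters = insert (Inl 1) (Inr ` {1..<int k})" using k by (simp add: letters_Z2_Zk)
  show "0 < R u" if "u \<in> Sigma_letters" for u using that R rho_pos unfolding L by auto
  show "(\<Sum>u\<in>Sigma_letters. R u) = 1" unfolding L using R sum_rho by (simp add: sum.reindex image_iff)
  show "prob_space \<nu>" unfolding \<nu>_eq by (rule prob_space_distr[OF Ym])
  show "sets \<nu> = sets (stream_space (count_space Sigma_letters))" by (simp add: \<nu>_eq)
  fix w assume w: "w \<in> words k" "w \<noteq> []"
  then obtain u z where uz: "w = u # z" by (cases w) auto
  have "sstart Sigma_letters w \<in> sets (stream_space (count_space Sigma_letters))"
    using w by (intro sstart_in_sets) (auto simp: normal_words_def)
  then have "measure \<nu> (sstart Sigma_letters w) = cylinder_potential w []"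
    unfolding \<nu>_eq using prob_limit_word_starts[OF Y w(1)] by (simp add: measure_distr[OF Ym])
  then show "measure \<nu> (sstart Sigma_letters w) =
      (\<Prod>i < length w - 1. R (w ! i) / (\<Sum>v \<in> {v \<in> Sigma_letters. isl v \<noteq> isl (w ! i)}. R v)) * R (last w)"
    using markov_mass_eq[of R u z] R w unfolding uz by simp
qed

end
end

theorem theorem4p3:
  fixes M :: "nat \<Rightarrow> 'w measure"
    and x :: "nat \<Rightarrow> nat \<Rightarrow> 'w \<Rightarrow> (int + int) list"
    and X :: "nat \<Rightarrow> nat \<Rightarrow> 'w \<Rightarrow> (int + int) list"
  assumes steps: "\<And>k. k \<ge> 3 \<Longrightarrow> iid_steps (M k) (simple_step k) (x k)"
    and walk: "\<And>k. k \<ge> 3 \<Longrightarrow> X k = right_walk (Z2_Zk k) (x k)"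
  shows
    "(\<forall>k\<ge>3.
        (\<exists>!y. y \<in> {0<..<1/2} \<and> Gn (k - 1) y = y) \<and>
        (\<exists>!\<nu>. is_harmonic_measure (integer_mod_group 2) (integer_mod_group k) (M k) (X k) \<nu>) \<and>
        (\<forall>\<nu> r. is_harmonic_measure (integer_mod_group 2) (integer_mod_group k) (M k) (X k) \<nu> \<longrightarrow>
           r (Inl 1) = Gn 0 (yk k) \<longrightarrow>
           (\<forall>i\<in>{1..k-1}. r (Inr (int i)) = Gn i (yk k)) \<longrightarrow>
           markovian_multiplicative (integer_mod_group 2) (integer_mod_group k) r \<nu>) \<and>
        (AE \<omega> in M k. (\<lambda>n. real (length (X k n \<omega>)) / real n) \<longlonglongrightarrow> drift (M k) (X k)) \<and>
        drift (M k) (X k) = (1 - 2 * yk k) / 3) \<and>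
     strict_mono_on {3..} (\<lambda>k. drift (M k) (X k)) \<and>
     (\<lambda>k. drift (M k) (X k)) \<longlonglongrightarrow> 2 / 9"
proof -
  have speed: "AE \<omega> in M k. (\<lambda>n. real (length (X k n \<omega>)) / real n) \<longlonglongrightarrow> (1 - 2 * yk k) / 3"
    and drift: "drift (M k) (X k) = (1 - 2 * yk k) / 3" if k: "k \<ge> 3" for k
  proof -
    interpret letter_weights k "yk k" using k yk[OF k] by unfold_locales
    show AE: "AE \<omega> in M k. (\<lambda>n. real (length (X k n \<omega>)) / real n) \<longlonglongrightarrow> (1 - 2 * yk k) / 3"
      using AE_speed[OF steps[OF k]] by (simp add: walk[OF k] speed_def)
    show "drift (M k) (X k) = (1 - 2 * yk k) / 3"
      using steps[OF k] by (intro drift_eq AE) (simp add: iid_steps_def)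
  qed
  have main: "(\<exists>!\<nu>. is_harmonic_measure (integer_mod_group 2) (integer_mod_group k) (M k) (X k) \<nu>) \<and>
      (\<forall>\<nu> r. is_harmonic_measure (integer_mod_group 2) (integer_mod_group k) (M k) (X k) \<nu> \<longrightarrow>
         r (Inl 1) = Gn 0 (yk k) \<longrightarrow>
         (\<forall>i\<in>{1..k-1}. r (Inr (int i)) = Gn i (yk k)) \<longrightarrow>
         markovian_multiplicative (integer_mod_group 2) (integer_mod_group k) r \<nu>)" if k: "k \<ge> 3" for k
  proof (intro conjI allI impI)
    interpret letter_weights k "yk k" using k yk[OF k] by unfold_locales
    interpret prob_space "M k" using steps[OF k] by (simp add: iid_steps_def)
    show "\<exists>!\<nu>. is_harmonic_measure (integer_mod_group 2) (integer_mod_group k) (M k) (X k) \<nu>"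
      unfolding walk[OF k] by (rule ex1_harmonic_measure[OF ex_limit_word[OF steps[OF k]]])
    fix \<nu> and R :: "int + int \<Rightarrow> real"
    assume \<nu>: "is_harmonic_measure (integer_mod_group 2) (integer_mod_group k) (M k) (X k) \<nu>"
      and R: "R (Inl 1) = Gn 0 (yk k)" "\<forall>i\<in>{1..k-1}. R (Inr (int i)) = Gn i (yk k)"
    show "markovian_multiplicative (integer_mod_group 2) (integer_mod_group k) R \<nu>"
    proof (rule harmonic_measure_markovian[OF steps[OF k]])
      show "R (Inl 1) = r" using R(1) rho_0 by simp
      fix i assume i: "i \<in> {1..<int k}"
      then have "nat i \<in> {1..k-1}" "nat i < k" by auto
      then show "R (Inr i) = rho i" using R(2)[rule_format, of "nat i"] rho_nat[of "nat i"] i by simp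
    qed (use \<nu> walk[OF k] in simp)
  qed
  have "strict_mono_on {3..} (\<lambda>k. drift (M k) (X k))"
    using yk_strict_antimono by (intro strict_mono_onI) (simp add: drift)
  \<comment> \<open>The drift is known from \<open>k = 3\<close> on, so the limit is transferred
    along an eventual equality; its value comes from \<open>y = 1/6\<close>.\<close>
  moreover have "(\<lambda>k. drift (M k) (X k)) \<longlonglongrightarrow> 2 / 9"
  proof (rule Lim_transform_eventually)
    have "(\<lambda>k. (1 - 2 * yk k) / 3) \<longlonglongrightarrow> (1 - 2 * (1/6)) / 3"
      by (intro tendsto_intros yk_tendsto) simp
    then show "(\<lambda>k. (1 - 2 * yk k) / 3) \<longlonglongrightarrow> 2 / 9" by simp
    show "\<forall>\<^sub>F k in sequentially. (1 - 2 * yk k) / 3 = drift (M k) (X k)"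
      using eventually_ge_at_top[of 3] by eventually_elim (simp add: drift)
  qed
  ultimately show ?thesis
  proof (intro conjI)
    show "\<forall>k\<ge>3.
        (\<exists>!y. y \<in> {0<..<1/2} \<and> Gn (k - 1) y = y) \<and>
        (\<exists>!\<nu>. is_harmonic_measure (integer_mod_group 2) (integer_mod_group k) (M k) (X k) \<nu>) \<and>
        (\<forall>\<nu> r. is_harmonic_measure (integer_mod_group 2) (integer_mod_group k) (M k) (X k) \<nu> \<longrightarrow>
           r (Inl 1) = Gn 0 (yk k) \<longrightarrow>
           (\<forall>i\<in>{1..k-1}. r (Inr (int i)) = Gn i (yk k)) \<longrightarrow>
           markovian_multiplicative (integer_mod_group 2) (integer_mod_group k) r \<nu>) \<and>
        (AE \<omega> in M k. (\<lambda>n. real (length (X k n \<omega>)) / real n) \<longlonglongrightarrow> drift (M k) (X k)) \<and>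
        drift (M k) (X k) = (1 - 2 * yk k) / 3" (is "\<forall>k\<ge>3. ?P k")
    proof (intro allI impI)
      fix k :: nat
      assume k: "3 \<le> k"
      have AE: "AE \<omega> in M k. (\<lambda>n. real (length (X k n \<omega>)) / real n) \<longlonglongrightarrow> drift (M k) (X k)"
        using speed[OF k] by (simp only: drift[OF k])
      show "?P k"
        by (intro conjI ex1_Gn_root[OF k] main[OF k, THEN conjunct1] main[OF k, THEN conjunct2] AE drift[OF k])
    qed
  qed
qed

end
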